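(* Let $d\in\mathbb{N}$ and let $Z:\mathrm{Conv}^*_{\mathrm{cd}}(\mathbb{R}^n)\to\mathbb{R}$ be a continuous polynomial valuation of degree at most $d$. Then $Z$ extends uniquely by continuity to a continuous valuation on $\mathrm{Conv}(\mathbb{R}^n;\mathbb{R})$.
   Context: $\mathrm{Conv}(\mathbb{R}^n;\mathbb{R})$ is the set of all finite convex functions $f:\mathbb{R}^n\to\mathbb{R}$, with the topology of epi-convergence (on this set equivalent to uniform convergence on compact subsets of $\mathbb{R}^n$). $\mathrm{Conv}^*_{\mathrm{cd}}(\mathbb{R}^n)\subset\mathrm{Conv}(\mathbb{R}^n;\mathbb{R})$ is the subset of all functions of the form $x\mapsto h_K(x,-1)$, where $K$ ranges over the non-empty compact convex subsets of $\mathbb{R}^{n+1}=\mathbb{R}^n\times\mathbb{R}$ and $h_K(z)=\sup_{w\in K}\langle z,w\rangle$; it carries the induced topology. For a set $\Gamma$ of convex functions, $Z:\Gamma\to\mathbb{R}$ is a valuation if $Z(f\vee h)+Z(f\wedge h)=Z(f)+Z(h)$ whenever $f,h\in\Gamma$ and the pointwise maximum $f\vee h$ and minimum $f\wedge h$ belong to $\Gamma$. If $\Gamma$ is closed under addition of affine functions, $Z$ is polynomial of degree at most $d$ if for every $f\in\Gamma$ the map $\ell\mapsto Z(f+\ell)$ is a polynomial of degree at most $d$ on the space $\mathrm{Aff}(n)\cong\mathbb{R}^{n+1}$ of affine functions $\ell:\mathbb{R}^n\to\mathbb{R}$. *)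

theory Defs
  imports "HOL-Analysis.Analysis"
begin

definition Conv :: "('a::euclidean_space \<Rightarrow> real) set" where
  "Conv = {f. convex_on UNIV f}"

definition epi_converges :: "(nat \<Rightarrow> 'a::euclidean_space \<Rightarrow> real) \<Rightarrow> ('a \<Rightarrow> real) \<Rightarrow> bool" where
  "epi_converges F f \<longleftrightarrow>
     (\<forall>x. (\<forall>X. X \<longlonglongrightarrow> x \<longrightarrow> ereal (f x) \<le> liminf (\<lambda>k. ereal (F k (X k)))) \<and>
          (\<exists>X. X \<longlonglongrightarrow> x \<and> (\<lambda>k. F k (X k)) \<longlonglongrightarrow> f x))"

text \<open>
  Epi-convergence on \<^const>\<open>Conv\<close> is induced by a metric, so its topology consists of the
  sequentially open sets.
\<close>

definition epi_topology :: "('a::euclidean_space \<Rightarrow> real) topology" where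
  "epi_topology = topology (\<lambda>U. U \<subseteq> Conv \<and>
     (\<forall>F. \<forall>f\<in>U. (\<forall>k. F k \<in> Conv) \<longrightarrow> epi_converges F f \<longrightarrow> (\<forall>\<^sub>F k in sequentially. F k \<in> U)))"

lemma openin_epi_topology:
  fixes U :: "('a::euclidean_space \<Rightarrow> real) set"
  shows "openin epi_topology U \<longleftrightarrow> U \<subseteq> Conv \<and>
     (\<forall>F. \<forall>f\<in>U. (\<forall>k. F k \<in> Conv) \<longrightarrow> epi_converges F f \<longrightarrow> (\<forall>\<^sub>F k in sequentially. F k \<in> U))"
proof -
  let ?op = "\<lambda>U :: ('a \<Rightarrow> real) set. U \<subseteq> Conv \<and>
     (\<forall>F. \<forall>f\<in>U. (\<forall>k. F k \<in> Conv) \<longrightarrow> epi_converges F f \<longrightarrow> (\<forall>\<^sub>F k in sequentially. F k \<in> U))"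
  have int: "?op (S \<inter> T)" if "?op S" "?op T" for S T
    using that unfolding Int_iff eventually_conj_iff by blast
  have un: "?op (\<Union>\<K>)" if K: "\<forall>S\<in>\<K>. ?op S" for \<K>
  proof -
    have "\<forall>\<^sub>F k in sequentially. F k \<in> \<Union>\<K>"
      if "f \<in> \<Union>\<K>" "\<forall>k. F k \<in> Conv" "epi_converges F f" for F f
    proof -
      from that obtain S where S: "S \<in> \<K>" "f \<in> S" by blast
      with K that have "\<forall>\<^sub>F k in sequentially. F k \<in> S" by blast
      then show ?thesis by (rule eventually_mono) (use S in blast)
    qed
    with K show ?thesis by blast
  qed
  have "istopology ?op"
    unfolding istopology_def using int un by blast
  then show ?thesis
    by (simp add: epi_topology_def topology_inverse')
qed

lemma topspace_epi_topology [simp]: "topspace epi_topology = Conv"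
proof
  show "topspace epi_topology \<subseteq> Conv"
    using openin_epi_topology openin_topspace by blast
  have "openin epi_topology Conv"
    by (simp add: openin_epi_topology)
  then show "Conv \<subseteq> topspace epi_topology"
    by (rule openin_subset)
qed

definition support_function :: "'a::euclidean_space set \<Rightarrow> 'a \<Rightarrow> real" where
  "support_function K z = (SUP w\<in>K. z \<bullet> w)"

definition Conv_cd :: "('a::euclidean_space \<Rightarrow> real) set" where
  "Conv_cd = {\<lambda>x. support_function K (x, -1) | K :: ('a \<times> real) set.
                K \<noteq> {} \<and> compact K \<and> convex K}"

lemma bdd_above_inner_compact:
  assumes "compact (K :: 'a::euclidean_space set)"
  shows "bdd_above ((\<lambda>w. z \<bullet> w) ` K)"
  by (intro bounded_imp_bdd_above compact_imp_bounded compact_continuous_image assms continuous_intros)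

lemma Conv_cd_subset_Conv: "Conv_cd \<subseteq> Conv"
proof
  fix f :: "'a \<Rightarrow> real" assume "f \<in> Conv_cd"
  then obtain K :: "('a \<times> real) set"
    where K: "K \<noteq> {}" "compact K" and f: "f = (\<lambda>x. support_function K (x, -1))"
    by (auto simp: Conv_cd_def)
  have "convex_on UNIV f"
  proof (rule convex_onI)
    fix t :: real and x y :: 'a assume t: "0 < t" "t < 1"
    have "((1 - t) *\<^sub>R x + t *\<^sub>R y, -1) \<bullet> w \<le> (1 - t) * f x + t * f y" if w: "w \<in> K" for w
    proof -
      have "((1 - t) *\<^sub>R x + t *\<^sub>R y, -1) \<bullet> w = (1 - t) * ((x, -1) \<bullet> w) + t * ((y, -1) \<bullet> w)"
        by (cases w) (simp add: inner_add_left algebra_simps)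
      also have "\<dots> \<le> (1 - t) * f x + t * f y"
        unfolding f support_function_def using t w
        by (intro add_mono mult_left_mono cSUP_upper bdd_above_inner_compact K) auto
      finally show ?thesis .
    qed
    then show "f ((1 - t) *\<^sub>R x + t *\<^sub>R y) \<le> (1 - t) * f x + t * f y"
      unfolding f support_function_def[of K "((1 - t) *\<^sub>R x + t *\<^sub>R y, -1)"]
      by (intro cSUP_least K) (simp add: f)
  qed simp
  then show "f \<in> Conv" by (simp add: Conv_def)
qed

definition valuation_on :: "('a \<Rightarrow> real) set \<Rightarrow> (('a \<Rightarrow> real) \<Rightarrow> real) \<Rightarrow> bool" where
  "valuation_on \<Gamma> Z \<longleftrightarrow>
     (\<forall>f\<in>\<Gamma>. \<forall>h\<in>\<Gamma>. (\<lambda>x. max (f x) (h x)) \<in> \<Gamma> \<longrightarrow> (\<lambda>x. min (f x) (h x)) \<in> \<Gamma> \<longrightarrow>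
        Z (\<lambda>x. max (f x) (h x)) + Z (\<lambda>x. min (f x) (h x)) = Z f + Z h)"

text \<open>
  The index \<open>m\<close> ranges over the multi-indices on the coordinates of \<^typ>\<open>'a\<close> of total degree at
  most \<open>d\<close>.
\<close>

definition polynomial_of_degree_le :: "nat \<Rightarrow> ('a::euclidean_space \<Rightarrow> real) \<Rightarrow> bool" where
  "polynomial_of_degree_le d p \<longleftrightarrow>
     (\<exists>c. \<forall>v. p v = (\<Sum>m | m \<in> Basis \<rightarrow>\<^sub>E UNIV \<and> (\<Sum>b\<in>Basis. m b) \<le> d.
                        c m * (\<Prod>b\<in>Basis. (v \<bullet> b) ^ m b)))"

lemma finite_multi_indices:
  "finite {m \<in> (Basis :: 'a::euclidean_space set) \<rightarrow>\<^sub>E (UNIV :: nat set). (\<Sum>b\<in>Basis. m b) \<le> d}"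
proof (rule finite_subset)
  show "{m \<in> (Basis :: 'a set) \<rightarrow>\<^sub>E (UNIV :: nat set). (\<Sum>b\<in>Basis. m b) \<le> d} \<subseteq> Basis \<rightarrow>\<^sub>E {..d}"
  proof
    fix m assume m: "m \<in> {m \<in> (Basis :: 'a set) \<rightarrow>\<^sub>E (UNIV :: nat set). (\<Sum>b\<in>Basis. m b) \<le> d}"
    have "m b \<le> d" if "b \<in> Basis" for b
      using m member_le_sum[of b Basis m] that by fastforce
    then show "m \<in> Basis \<rightarrow>\<^sub>E {..d}"
      using m by (auto simp: PiE_def Pi_def)
  qed
qed (simp add: finite_PiE)

text \<open>
  The affine function \<open>\<lambda>x. a \<bullet> x + c\<close> is identified with the pair \<open>(a, c)\<close>.
\<close>

definition polynomial_on :: "nat \<Rightarrow> ('a::euclidean_space \<Rightarrow> real) set \<Rightarrow> (('a \<Rightarrow> real) \<Rightarrow> real) \<Rightarrow> bool" where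
  "polynomial_on d \<Gamma> Z \<longleftrightarrow>
     (\<forall>f\<in>\<Gamma>. polynomial_of_degree_le d (\<lambda>(a, c). Z (\<lambda>x. f x + (a \<bullet> x + c))))"

lemma Conv_cd_add_affine:
  assumes "f \<in> Conv_cd"
  shows "(\<lambda>x. f x + (a \<bullet> x + c)) \<in> Conv_cd"
proof -
  obtain K :: "('a \<times> real) set"
    where K: "K \<noteq> {}" "compact K" "convex K" and f: "f = (\<lambda>x. support_function K (x, -1))"
    using assms by (auto simp: Conv_cd_def)
  have "f x + (a \<bullet> x + c) = support_function ((+) (a, -c) ` K) (x, -1)" for x
  proof -
    have "continuous_on K (\<lambda>w. (x, -1) \<bullet> w)"
      by (intro continuous_intros)
    then obtain w where w: "w \<in> K" "\<And>v. v \<in> K \<Longrightarrow> (x, -1) \<bullet> v \<le> (x, -1) \<bullet> w"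
      using continuous_attains_sup K by metis
    have "f x = (x, -1) \<bullet> w"
      unfolding f support_function_def by (rule cSup_eq_maximum) (use w in auto)
    moreover have "support_function ((+) (a, -c) ` K) (x, -1) = (x, -1) \<bullet> ((a, -c) + w)"
      unfolding support_function_def
    proof (rule cSup_eq_maximum)
      show "(x, -1) \<bullet> ((a, -c) + w) \<in> (\<bullet>) (x, -1) ` (+) (a, -c) ` K"
        using w(1) by (intro imageI)
      show "y \<le> (x, -1) \<bullet> ((a, -c) + w)" if "y \<in> (\<bullet>) (x, -1) ` (+) (a, -c) ` K" for y
      proof -
        from that obtain v where "v \<in> K" "y = (x, -1) \<bullet> ((a, -c) + v)" by blast
        then show ?thesis
          using w(2)[of v] by (simp only: inner_add_right add_left_mono)
      qed
    qed
    ultimately show ?thesis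
      by (simp add: inner_add_right inner_commute)
  qed
  moreover have "(+) (a, -c) ` K \<noteq> {}" "compact ((+) (a, -c) ` K)" "convex ((+) (a, -c) ` K)"
    using K by (auto intro: compact_translation convex_translation)
  ultimately show ?thesis
    unfolding Conv_cd_def by blast
qed

end

theory Submission
  imports Defs "HOL-Computational_Algebra.Polynomial"
begin

text \<open>
  The crux is that \<open>Z\<close> is local: there is a radius \<open>R\<close> such that \<open>Z f\<close> depends only on the
  restriction of \<open>f\<close> to the ball of radius \<open>R\<close>. Continuity at 0 bounds \<open>Z\<close> near 0 in terms of
  such a restriction. For a maximum \<open>G\<close> of finitely many affine functions, the canonical
  subdivision of a dilated simplex makes \<open>Z (f + a G)\<close> a polynomial in \<open>a \<ge> 0\<close>; if \<open>G\<close> vanishes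
  on the ball, this polynomial is bounded for small affine \<open>f\<close>, hence constant, and polynomiality
  in \<open>f\<close> removes the smallness. The valuation property then gives \<open>Z (f \<or> l) = Z f\<close> for affine
  \<open>l < f\<close> on the ball, and locality follows by approximation.

  Given locality, \<open>Z\<close> is extended to a convex function \<open>f\<close> by its value at the largest
  \<open>L\<close>-Lipschitz function below \<open>f\<close> on the ball, for large \<open>L\<close>. This regularization lies in
  \<^const>\<open>Conv_cd\<close>, agrees with \<open>f\<close> on the ball, is continuous in \<open>f\<close> and commutes with minima.
\<close>

section \<open>Maxima of affine functions\<close>

text \<open>The obstacle is that \<open>Conv_cd\<close> is stable under maxima but not under minima,
  so the valuation property may be invoked only where a minimum is known to lie in
  \<open>Conv_cd\<close>. This dictates the subdivision: its pieces are sums of two scaled maxima,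
  and each new piece meets the union of the earlier ones in a sum of the same kind. Continuity
  controls \<open>Z\<close> only near 0 and only through a ball, while \<open>a * G\<close> becomes
  arbitrarily large outside that ball. If \<open>G\<close> vanishes on the ball, this control cannot
  see \<open>a\<close>, so it holds on the whole half-line; a polynomial in \<open>a\<close> is then
  forced to be constant. Polynomiality in \<open>a\<close> comes from an induction on the number of
  affine functions: the cut expresses the difference between the dilations \<open>a + b\<close> and
  \<open>a\<close> by terms in which \<open>a\<close> multiplies a maximum of fewer of them. No
  Lipschitz constant serves all convex functions at once. Locality makes the value independent of
  this constant, so it can be chosen common to the functions under comparison.\<close>

definition aff :: "'a::euclidean_space \<times> real \<Rightarrow> 'a \<Rightarrow> real" where
  "aff p x = fst p \<bullet> x + snd p"

lemma aff_add: "aff (p + q) x = aff p x + aff q x"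
  by (simp add: aff_def algebra_simps)

lemma aff_scaleR: "aff (c *\<^sub>R p) x = c * aff p x"
  by (simp add: aff_def algebra_simps)

lemma aff_minus: "aff (- p) x = - aff p x"
  by (simp add: aff_def)

lemma aff_zero [simp]: "aff 0 x = 0"
  by (simp add: aff_def)

lemma abs_aff_le: "\<bar>aff p x\<bar> \<le> norm p * (norm x + 1)"
proof -
  have "\<bar>aff p x\<bar> \<le> norm (fst p) * norm x + norm (snd p)"
    unfolding aff_def using Cauchy_Schwarz_ineq2[of "fst p" x] unfolding abs_le_iff by auto
  also have "\<dots> \<le> norm p * norm x + norm p"
    using norm_fst_le[of "fst p" "snd p"] norm_snd_le[of "snd p" "fst p"] by (intro add_mono mult_right_mono) simp_all
  finally show ?thesis by (simp add: algebra_simps)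
qed

text \<open>
  The point \<open>(a, c)\<close> of \<open>K\<close> stands for the affine function \<open>x \<mapsto> a \<bullet> x + c\<close>, so \<open>K\<close> is the mirror
  image of the set whose support function is evaluated at \<open>(x, -1)\<close>. Convexity of \<open>K\<close> is not
  required.
\<close>

definition max_affine :: "('a::euclidean_space \<times> real) set \<Rightarrow> ('a \<Rightarrow> real) \<Rightarrow> bool" where
  "max_affine K f \<longleftrightarrow> (\<forall>x. (\<exists>p\<in>K. f x = aff p x) \<and> (\<forall>p\<in>K. aff p x \<le> f x))"

text \<open>Passing to the convex hull does not change the supremum of a linear form, so every
  compact set of affine functions is admissible. Finite sets, unions and sets of minorants can thus
  serve directly as witnesses.\<close>

lemma Conv_cd_iff:
  fixes f :: "'a::euclidean_space \<Rightarrow> real"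
  shows "f \<in> Conv_cd \<longleftrightarrow> (\<exists>K. compact K \<and> max_affine K f)"
proof
  assume "f \<in> Conv_cd"
  then obtain K :: "('a \<times> real) set" where K: "K \<noteq> {}" "compact K" and f: "f = (\<lambda>x. support_function K (x, -1))"
    by (auto simp: Conv_cd_def)
  define T :: "'a \<times> real \<Rightarrow> 'a \<times> real" where "T p = (fst p, - snd p)" for p
  have T: "aff (T p) x = (x, -1) \<bullet> p" for p x
    by (cases p) (simp add: T_def aff_def inner_commute)
  have "compact (T ` K)"
    unfolding T_def by (intro compact_continuous_image continuous_intros K)
  moreover have "max_affine (T ` K) f"
    unfolding max_affine_def
  proof (intro allI)
    fix x
    have "continuous_on K (\<lambda>w. (x, -1) \<bullet> w)"
      by (intro continuous_intros)
    then obtain w where w: "w \<in> K" "\<And>v. v \<in> K \<Longrightarrow> (x, -1) \<bullet> v \<le> (x, -1) \<bullet> w"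
      using continuous_attains_sup K by metis
    have "f x = (x, -1) \<bullet> w"
      unfolding f support_function_def by (rule cSup_eq_maximum) (use w in auto)
    then show "(\<exists>p\<in>T ` K. f x = aff p x) \<and> (\<forall>p\<in>T ` K. aff p x \<le> f x)"
      using w by (auto simp: T)
  qed
  ultimately show "\<exists>K. compact K \<and> max_affine K f" by blast
next
  assume "\<exists>K. compact K \<and> max_affine K f"
  then obtain K where K: "compact K" "max_affine K f" by blast
  define T :: "'a \<times> real \<Rightarrow> 'a \<times> real" where "T p = (fst p, - snd p)" for p
  have T: "(x, -1) \<bullet> T p = aff p x" for p x
    by (cases p) (simp add: T_def aff_def inner_commute)
  define C where "C = convex hull (T ` K)"
  have "compact (T ` K)"
    unfolding T_def by (intro compact_continuous_image continuous_intros K)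
  then have "compact C" "convex C" by (auto simp: C_def compact_convex_hull)
  moreover have TC: "T ` K \<subseteq> C" unfolding C_def by (rule hull_subset)
  moreover have "K \<noteq> {}" using K(2) by (auto simp: max_affine_def)
  moreover have "f x = support_function C (x, -1)" for x
  proof -
    obtain p where p: "p \<in> K" "f x = aff p x" "\<And>q. q \<in> K \<Longrightarrow> aff q x \<le> f x"
      using K(2) unfolding max_affine_def by blast
    have "C \<subseteq> {w. (x, -1) \<bullet> w \<le> f x}"
      unfolding C_def by (rule hull_minimal) (use p(3) in \<open>auto simp: T convex_halfspace_le\<close>)
    then show ?thesis
      unfolding support_function_def using p TC
      by (intro cSup_eq_maximum[symmetric]) (auto simp: T image_iff intro!: bexI[of _ "T p"])
  qed
  ultimately show "f \<in> Conv_cd" unfolding Conv_cd_def by blast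
qed

lemma Conv_cdI: "compact K \<Longrightarrow> max_affine K f \<Longrightarrow> f \<in> Conv_cd"
  using Conv_cd_iff by blast

lemma Conv_cdE:
  assumes "f \<in> Conv_cd"
  obtains K where "compact K" "max_affine K f"
  using assms Conv_cd_iff[of f] by auto

lemma aff_in_Conv_cd: "aff p \<in> Conv_cd"
  by (rule Conv_cdI[of "{p}"]) (auto simp: max_affine_def)

lemma Conv_cd_zero: "(\<lambda>x. 0) \<in> Conv_cd"
  using aff_in_Conv_cd[of 0] by (simp add: aff_def[abs_def])

text \<open>Sums of functions correspond to Minkowski sums of the representing sets; likewise maxima
  correspond to unions and nonnegative multiples to dilations.\<close>

lemma Conv_cd_add:
  assumes "f \<in> Conv_cd" "g \<in> Conv_cd"
  shows "(\<lambda>x. f x + g x) \<in> Conv_cd"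
proof -
  obtain K where K: "compact K" "max_affine K f" using assms(1) by (rule Conv_cdE)
  obtain L where L: "compact L" "max_affine L g" using assms(2) by (rule Conv_cdE)
  note * = K L
  have "max_affine {p + q | p q. p \<in> K \<and> q \<in> L} (\<lambda>x. f x + g x)"
    unfolding max_affine_def
  proof (intro allI conjI)
    fix x
    obtain p q where "p \<in> K" "f x = aff p x" "q \<in> L" "g x = aff q x"
      using * unfolding max_affine_def by blast
    moreover from this have "f x + g x = aff (p + q) x"
      by (simp add: aff_add)
    ultimately show "\<exists>p\<in>{p + q |p q. p \<in> K \<and> q \<in> L}. f x + g x = aff p x"
      by blast
    show "\<forall>p\<in>{p + q |p q. p \<in> K \<and> q \<in> L}. aff p x \<le> f x + g x"
    proof
      fix r assume "r \<in> {p + q |p q. p \<in> K \<and> q \<in> L}"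
      then obtain p q where "p \<in> K" "q \<in> L" "r = p + q" by blast
      with * show "aff r x \<le> f x + g x"
        by (simp add: aff_add max_affine_def add_mono)
    qed
  qed
  then show ?thesis using compact_sums[OF *(1,3)] Conv_cdI by blast
qed

lemma Conv_cd_max:
  assumes "f \<in> Conv_cd" "g \<in> Conv_cd"
  shows "(\<lambda>x. max (f x) (g x)) \<in> Conv_cd"
proof -
  obtain K where K: "compact K" "max_affine K f" using assms(1) by (rule Conv_cdE)
  obtain L where L: "compact L" "max_affine L g" using assms(2) by (rule Conv_cdE)
  note * = K L
  have "max_affine (K \<union> L) (\<lambda>x. max (f x) (g x))"
    unfolding max_affine_def
  proof (intro allI conjI)
    fix x
    show "\<exists>p\<in>K \<union> L. max (f x) (g x) = aff p x"
      using *(2,4) unfolding max_affine_def max_def by (metis UnCI)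
    show "\<forall>p\<in>K \<union> L. aff p x \<le> max (f x) (g x)"
      using *(2,4) unfolding max_affine_def by (metis UnE max.coboundedI1 max.coboundedI2)
  qed
  then show ?thesis using compact_Un[OF *(1,3)] Conv_cdI by blast
qed

lemma Conv_cd_scale:
  assumes "f \<in> Conv_cd" "c \<ge> 0"
  shows "(\<lambda>x. c * f x) \<in> Conv_cd"
proof -
  obtain K where *: "compact K" "max_affine K f" using assms(1) by (rule Conv_cdE)
  have "max_affine ((*\<^sub>R) c ` K) (\<lambda>x. c * f x)"
    unfolding max_affine_def
  proof (intro allI conjI)
    fix x
    show "\<exists>p\<in>(*\<^sub>R) c ` K. c * f x = aff p x"
      using *(2) unfolding max_affine_def bex_simps aff_scaleR by metis
    show "\<forall>p\<in>(*\<^sub>R) c ` K. aff p x \<le> c * f x"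
      using *(2) assms(2) by (auto simp: max_affine_def aff_scaleR intro: mult_left_mono)
  qed
  then show ?thesis using compact_scaling[OF *(1), of c] Conv_cdI by blast
qed

lemma Conv_cd_add_aff: "f \<in> Conv_cd \<Longrightarrow> (\<lambda>x. f x + aff p x) \<in> Conv_cd"
  using Conv_cd_add aff_in_Conv_cd by blast

section \<open>Locally uniform limits\<close>

lemma Conv_continuous:
  assumes "f \<in> Conv" shows "continuous_on S f"
proof -
  have "continuous_on UNIV f"
    using assms by (auto simp: Conv_def intro: convex_on_continuous)
  then show ?thesis by (rule continuous_on_subset) simp
qed

text \<open>The working form of convergence. Epi-convergence is translated into it and back at the
  interface with \<open>epi_topology\<close>; all limits of values of \<open>Z\<close> are taken in
  this form.\<close>

definition locally_uniform_limit :: "(nat \<Rightarrow> 'a::euclidean_space \<Rightarrow> real) \<Rightarrow> ('a \<Rightarrow> real) \<Rightarrow> bool" where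
  "locally_uniform_limit F f \<longleftrightarrow> (\<forall>r. uniform_limit (cball 0 r) F f sequentially)"

lemma locally_uniform_limitI:
  assumes "\<And>r e. e > 0 \<Longrightarrow> \<forall>\<^sub>F k in sequentially. \<forall>x\<in>cball 0 r. \<bar>F k x - f x\<bar> < e"
  shows "locally_uniform_limit F f"
  using assms by (simp add: locally_uniform_limit_def uniform_limit_iff dist_real_def)

lemma locally_uniform_limitD:
  assumes "locally_uniform_limit F f" "e > 0"
  shows "\<forall>\<^sub>F k in sequentially. \<forall>x\<in>cball 0 r. \<bar>F k x - f x\<bar> < e"
  using assms by (simp add: locally_uniform_limit_def uniform_limit_iff dist_real_def)

lemma epi_converges_if_locally_uniform_limit:
  assumes F: "locally_uniform_limit F f" and f: "continuous_on UNIV f"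
  shows "epi_converges F f"
proof -
  have lim: "(\<lambda>k. F k (X k)) \<longlonglongrightarrow> f x" if X: "X \<longlonglongrightarrow> x" for X x
  proof -
    have fX: "(\<lambda>k. f (X k)) \<longlonglongrightarrow> f x"
      using continuous_on_tendsto_compose[OF f X] by simp
    have "(\<lambda>k. F k (X k) - f (X k)) \<longlonglongrightarrow> 0"
    proof (rule tendstoI)
      fix e :: real assume "e > 0"
      from locally_uniform_limitD[OF F this]
      have "\<forall>\<^sub>F k in sequentially. \<forall>y\<in>cball 0 (norm x + 1). \<bar>F k y - f y\<bar> < e" .
      moreover have "\<forall>\<^sub>F k in sequentially. norm (X k) < norm x + 1"
        using tendsto_norm[OF X] by (rule order_tendstoD) simp
      ultimately show "\<forall>\<^sub>F k in sequentially. dist (F k (X k) - f (X k)) 0 < e"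
        by eventually_elim auto
    qed
    from tendsto_add[OF this fX] show ?thesis by simp
  qed
  have "liminf (\<lambda>k. ereal (F k (X k))) = ereal (f x)" if "X \<longlonglongrightarrow> x" for X x
    by (rule lim_imp_Liminf) (use lim[OF that] in auto)
  with lim show ?thesis
    unfolding epi_converges_def by (metis order_refl tendsto_const)
qed

lemma continuous_map_epi_tendsto:
  assumes Z: "continuous_map (subtopology epi_topology \<Gamma>) euclideanreal Z"
    and \<Gamma>: "\<Gamma> \<subseteq> Conv" and F: "\<And>k. F k \<in> \<Gamma>" "f \<in> \<Gamma>" "locally_uniform_limit F f"
  shows "(\<lambda>k. Z (F k)) \<longlonglongrightarrow> Z f"
proof (rule topological_tendstoI)
  fix S assume "open S" "Z f \<in> S"
  have "openin (subtopology epi_topology \<Gamma>) {g \<in> topspace (subtopology epi_topology \<Gamma>). Z g \<in> S}"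
    using Z \<open>open S\<close> by (auto simp: continuous_map_def)
  then obtain T where T: "openin epi_topology T"
    "{g \<in> topspace (subtopology epi_topology \<Gamma>). Z g \<in> S} = T \<inter> \<Gamma>"
    by (auto simp: openin_subtopology)
  have "epi_converges F f"
    using F \<Gamma> by (intro epi_converges_if_locally_uniform_limit Conv_continuous) auto
  moreover have "f \<in> T" using T(2) F \<Gamma> \<open>Z f \<in> S\<close> by auto
  ultimately have "\<forall>\<^sub>F k in sequentially. F k \<in> T"
    using T(1) F \<Gamma> unfolding openin_epi_topology by blast
  then show "\<forall>\<^sub>F k in sequentially. Z (F k) \<in> S"
    by (rule eventually_mono) (use T(2) F in auto)
qed

section \<open>Polynomial functions on the half-line\<close>

text \<open>Discrete integration: \<open>(a + 1) ^ Suc N - a ^ Suc N\<close> has leading term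
  \<open>Suc N * a ^ N\<close>, so the multiple by \<open>c\<close> cancels the coefficient of
  \<open>p\<close> at \<open>N\<close>, and the induction treats the remainder of lower
  degree.\<close>

lemma poly_antidifference:
  fixes p :: "real poly"
  assumes "degree p \<le> N"
  shows "\<exists>q. degree q \<le> Suc N \<and> (\<forall>a. poly q (a + 1) - poly q a = poly p a)"
  using assms
proof (induction N arbitrary: p rule: less_induct)
  case (less N)
  define c where "c = coeff p N / real (Suc N)"
  define m :: "real poly" where "m = smult c ([:0, 1:] ^ Suc N)"
  define r where "r = p - (smult c ([:1, 1:] ^ Suc N) - m)"
  have pr: "poly p a = poly r a + (poly m (a + 1) - poly m a)" for a
    by (simp add: r_def m_def add.commute del: power_Suc)
  have co: "coeff ([:1, 1:] ^ k :: real poly) i = of_nat (k choose i)" for k i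
  proof (cases "i \<le> k")
    case True
    then show ?thesis using coeff_linear_poly_power[of i k "1::real" 1] by simp
  next
    case False
    then show ?thesis by (simp add: binomial_eq_0 coeff_eq_0 degree_linear_power)
  qed
  have co0: "coeff ([:0, 1:] ^ k :: real poly) i = (if i = k then 1 else 0)" for k i
    by (simp flip: monom_altdef[of 1 k, simplified])
  have dm: "degree m \<le> Suc N"
    unfolding m_def by (rule order_trans[OF degree_smult_le]) (simp add: degree_linear_power del: power_Suc)
  have cr: "coeff r i = 0" if "i \<ge> N" for i
  proof (cases "i = N")
    case True
    then show ?thesis
      by (simp add: r_def co co0 m_def c_def del: power_Suc)
  next
    case False
    with that less.prems have "coeff p i = 0" "i \<ge> Suc N" by (auto intro!: coeff_eq_0)
    then show ?thesis
      by (cases "i = Suc N") (auto simp: r_def co co0 m_def binomial_eq_0 simp del: power_Suc binomial_Suc_Suc)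
  qed
  show ?case
  proof (cases N)
    case 0
    with cr have "r = 0" by (auto intro: poly_eqI)
    then show ?thesis
      using pr by (intro exI[of _ m]) (auto simp: dm)
  next
    case (Suc M)
    have "degree r \<le> M" using cr Suc by (intro degree_le) auto
    from less.IH[OF _ this] Suc obtain q where q: "degree q \<le> Suc M" "\<And>a. poly q (a + 1) - poly q a = poly r a"
      by auto
    have "degree (q + m) \<le> Suc N"
      using q(1) Suc dm by (intro degree_add_le) simp_all
    then show ?thesis using q(2) pr by (intro exI[of _ "q + m"]) (auto simp: algebra_simps)
  qed
qed

lemma poly_bounded_constant:
  fixes p :: "real poly"
  assumes "\<And>a. a \<ge> 0 \<Longrightarrow> \<bar>poly p a\<bar> \<le> B"
  shows "poly p a = poly p 0"
proof -
  have "degree p = 0"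
  proof (rule ccontr)
    assume "degree p \<noteq> 0"
    then have "filterlim (poly p) at_infinity at_infinity"
      by (intro filterlim_poly_at_infinity) simp
    then have "filterlim (poly p) at_infinity at_top"
      by (rule filterlim_mono[OF _ order_refl at_top_le_at_infinity])
    then have "\<forall>\<^sub>F a in at_top. norm (poly p a) \<ge> \<bar>B\<bar> + 1"
      by (simp add: filterlim_at_infinity[of 0])
    moreover have "\<forall>\<^sub>F a::real in at_top. a \<ge> 0" by (rule eventually_ge_at_top)
    ultimately have "\<forall>\<^sub>F a::real in at_top. False"
      by eventually_elim (use assms in fastforce)
    then show False by simp
  qed
  then obtain c where "p = [:c:]" by (rule degree_eq_zeroE)
  then show ?thesis by simp
qed

text \<open>Restricted to the half-line because \<open>f + a * G\<close> need not be convex for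
  negative \<open>a\<close>.\<close>

definition poly_fun_le :: "nat \<Rightarrow> (real \<Rightarrow> real) \<Rightarrow> bool" where
  "poly_fun_le N g \<longleftrightarrow> (\<exists>p. degree p \<le> N \<and> (\<forall>a\<ge>0. g a = poly p a))"

lemma poly_fun_le_mono: "poly_fun_le N g \<Longrightarrow> N \<le> M \<Longrightarrow> poly_fun_le M g"
  unfolding poly_fun_le_def by (meson order_trans)

lemma poly_fun_le_cong: "(\<And>a. a \<ge> 0 \<Longrightarrow> g a = h a) \<Longrightarrow> poly_fun_le N g \<longleftrightarrow> poly_fun_le N h"
  unfolding poly_fun_le_def by auto

lemma poly_fun_le_add:
  assumes "poly_fun_le N g" "poly_fun_le N h"
  shows "poly_fun_le N (\<lambda>a. g a + h a)"
proof -
  from assms obtain p q where "degree p \<le> N" "degree q \<le> N"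
    "\<And>a. a \<ge> 0 \<Longrightarrow> g a = poly p a" "\<And>a. a \<ge> 0 \<Longrightarrow> h a = poly q a"
    unfolding poly_fun_le_def by auto
  then show ?thesis
    unfolding poly_fun_le_def by (intro exI[of _ "p + q"]) (auto simp: degree_add_le)
qed

lemma poly_fun_le_const: "poly_fun_le N (\<lambda>a. c)"
  unfolding poly_fun_le_def by (intro exI[of _ "[:c:]"]) auto

lemma poly_fun_le_cmult:
  assumes "poly_fun_le N g"
  shows "poly_fun_le N (\<lambda>a. c * g a)"
proof -
  from assms obtain p where "degree p \<le> N" "\<And>a. a \<ge> 0 \<Longrightarrow> g a = poly p a"
    unfolding poly_fun_le_def by auto
  then show ?thesis
    unfolding poly_fun_le_def by (intro exI[of _ "smult c p"]) (auto intro: order_trans[OF degree_smult_le])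
qed

lemma poly_fun_le_diff:
  assumes "poly_fun_le N g" "poly_fun_le N h"
  shows "poly_fun_le N (\<lambda>a. g a - h a)"
  using poly_fun_le_add[OF assms(1) poly_fun_le_cmult[OF assms(2), of "-1"]] by simp

lemma poly_fun_le_sum:
  assumes "\<And>i. i \<in> I \<Longrightarrow> poly_fun_le N (g i)"
  shows "poly_fun_le N (\<lambda>a. \<Sum>i\<in>I. g i a)"
  using assms by (induction I rule: infinite_finite_induct) (auto intro: poly_fun_le_add poly_fun_le_const)

lemma poly_fun_le_power_mult:
  assumes "poly_fun_le N g"
  shows "poly_fun_le (i + N) (\<lambda>a. a ^ i * g a)"
proof -
  from assms obtain p where p: "degree p \<le> N" "\<And>a. a \<ge> 0 \<Longrightarrow> g a = poly p a"
    unfolding poly_fun_le_def by auto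
  have "degree (monom 1 i * p) \<le> i + N"
    using degree_mult_le[of "monom 1 i" p] degree_monom_le[of "1::real" i] p(1) by linarith
  then show ?thesis
    unfolding poly_fun_le_def using p(2)
    by (intro exI[of _ "monom 1 i * p"]) (auto simp: poly_monom)
qed

text \<open>
  After subtracting a polynomial, \<open>g\<close> is 1-periodic and hence bounded; its differences are then
  bounded polynomials, so constant and additive in \<open>b\<close>, and boundedness forces them to vanish.
\<close>

lemma poly_fun_le_if_differences:
  fixes g :: "real \<Rightarrow> real"
  assumes cont: "continuous_on {0..} g"
    and diff: "\<And>b. b \<ge> 0 \<Longrightarrow> poly_fun_le N (\<lambda>a. g (a + b) - g a)"
  shows "poly_fun_le (Suc N) g"
proof -
  obtain p where p: "degree p \<le> N" "\<And>a. a \<ge> 0 \<Longrightarrow> g (a + 1) - g a = poly p a"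
    using diff[of 1] unfolding poly_fun_le_def by auto
  obtain q where q: "degree q \<le> Suc N" "\<And>a. poly q (a + 1) - poly q a = poly p a"
    using poly_antidifference[OF p(1)] by blast
  define h where "h a = g a - poly q a" for a
  have h1: "h (a + 1) = h a" if "a \<ge> 0" for a
    using p(2)[OF that] q(2)[of a] by (simp add: h_def)
  have hn: "h (a + real n) = h a" if "a \<ge> 0" for a n
    by (induction n) (use h1[of "a + real _"] that in \<open>auto simp: add_ac\<close>)
  have "continuous_on {0..1} h"
    unfolding h_def by (intro continuous_intros continuous_on_subset[OF cont]) auto
  then have "bounded (h ` {0..1})"
    by (intro compact_imp_bounded compact_continuous_image) auto
  then obtain B where "\<forall>y\<in>h ` {0..1}. norm y \<le> B"
    unfolding bounded_iff by blast
  then have B: "\<bar>h a\<bar> \<le> B" if "a \<in> {0..1}" for a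
    using that by simp
  have hB: "\<bar>h a\<bar> \<le> B" if "a \<ge> 0" for a
  proof -
    have "h a = h (frac a + real (nat \<lfloor>a\<rfloor>))"
      using that by (simp add: frac_def)
    also have "\<dots> = h (frac a)" by (rule hn) simp
    finally show ?thesis using B[of "frac a"] frac_lt_1[of a] by simp
  qed
  have const: "h (a + b) - h a = h b - h 0" if ab: "a \<ge> 0" "b \<ge> 0" for a b
  proof -
    obtain r where r: "\<And>a. a \<ge> 0 \<Longrightarrow> g (a + b) - g a = poly r a"
      using diff[OF ab(2)] unfolding poly_fun_le_def by auto
    define s where "s = r - (pcompose q [:b, 1:] - q)"
    have s: "h (a + b) - h a = poly s a" if "a \<ge> 0" for a
      using r[OF that] by (simp add: h_def s_def poly_pcompose add.commute)
    have "\<bar>poly s a\<bar> \<le> 2 * B" if "a \<ge> 0" for a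
      using s[OF that] hB[OF that] hB[of "a + b"] that ab by simp
    then have "poly s a = poly s 0" by (rule poly_bounded_constant)
    then show ?thesis using s[of a] s[of 0] ab by simp
  qed
  have hconst: "h b = h 0" if b: "b \<ge> 0" for b
  proof (rule ccontr)
    assume "h b \<noteq> h 0"
    then obtain n where n: "real n * \<bar>h b - h 0\<bar> > 2 * B"
      using reals_Archimedean3[of "\<bar>h b - h 0\<bar>"] by auto
    have "h (real n * b) - h 0 = real n * (h b - h 0)" for n
    proof (induction n)
      case (Suc n)
      have "h (real (Suc n) * b) = h (real n * b + b)" by (simp add: algebra_simps)
      then show ?case using const[of "real n * b" b] b Suc by (simp add: algebra_simps)
    qed simp
    then have "real n * \<bar>h b - h 0\<bar> = \<bar>h (real n * b) - h 0\<bar>"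
      by (simp add: abs_mult)
    also have "\<dots> \<le> 2 * B" using hB[of "real n * b"] hB[of 0] b by simp
    finally show False using n by simp
  qed
  have "g a = poly (q + [:h 0:]) a" if "a \<ge> 0" for a
    using hconst[OF that] h_def[of a] by simp
  moreover have "degree (q + [:h 0:]) \<le> Suc N"
    using q(1) by (intro degree_add_le) auto
  ultimately show ?thesis unfolding poly_fun_le_def by blast
qed

text \<open>The weights \<open>L i j\<close> depend on \<open>N\<close> alone. Hence the
  coefficients of a polynomial that varies with a parameter inherit every linear property of its
  values at the nodes \<open>0, ..., N\<close>.\<close>

lemma lagrange_coefficients:
  obtains L :: "nat \<Rightarrow> nat \<Rightarrow> real"
  where "\<And>p i. degree p \<le> N \<Longrightarrow> coeff p i = (\<Sum>j\<le>N. L i j * poly p (real j))"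
proof -
  define l :: "nat \<Rightarrow> real poly"
    where "l j = (\<Prod>k\<in>{..N} - {j}. smult (1 / (real j - real k)) [:- real k, 1:])" for j
  have ldeg: "degree (l j) \<le> N" if "j \<le> N" for j
  proof -
    have "degree (l j) \<le> (\<Sum>k\<in>{..N} - {j}. degree (smult (1 / (real j - real k)) [:- real k, 1:]))"
      unfolding l_def by (rule order_trans[OF degree_prod_sum_le]) (auto simp: o_def)
    also have "\<dots> \<le> (\<Sum>k\<in>{..N} - {j}. 1)"
      by (intro sum_mono) (auto intro: order_trans[OF degree_smult_le])
    also have "\<dots> = N" using that by simp
    finally show ?thesis .
  qed
  have lval: "poly (l j) (real i) = (if i = j then 1 else 0)" if "i \<le> N" "j \<le> N" for i j
  proof (cases "i = j")
    case True
    have "poly (l j) (real j) = (\<Prod>k\<in>{..N} - {j}. (1 / (real j - real k)) * (real j - real k))"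
      by (simp only: l_def poly_prod poly_smult poly_pCons) (simp add: algebra_simps)
    also have "\<dots> = 1" by (rule prod.neutral) simp
    finally show ?thesis using True by simp
  next
    case False
    then show ?thesis using that by (auto simp: l_def poly_prod intro!: bexI[of _ i])
  qed
  have interp: "p = (\<Sum>j\<le>N. smult (poly p (real j)) (l j))" if p: "degree p \<le> N" for p
  proof (rule ccontr)
    define r where "r = p - (\<Sum>j\<le>N. smult (poly p (real j)) (l j))"
    assume "p \<noteq> (\<Sum>j\<le>N. smult (poly p (real j)) (l j))"
    then have "r \<noteq> 0" by (simp add: r_def)
    have "degree r \<le> N"
      unfolding r_def using p ldeg
      by (intro degree_diff_le degree_sum_le) (auto intro: order_trans[OF degree_smult_le])
    have "poly r (real i) = 0" if "i \<le> N" for i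
    proof -
      have "(\<Sum>j\<le>N. poly p (real j) * poly (l j) (real i)) = (\<Sum>j\<le>N. if i = j then poly p (real j) else 0)"
        using that by (intro sum.cong) (auto simp: lval)
      then show ?thesis using that by (simp add: r_def poly_sum)
    qed
    then have "real ` {..N} \<subseteq> {x. poly r x = 0}" by auto
    then have "card (real ` {..N}) \<le> card {x. poly r x = 0}"
      by (intro card_mono poly_roots_finite \<open>r \<noteq> 0\<close>)
    also have "\<dots> \<le> degree r" by (rule card_poly_roots_bound) fact
    finally show False using \<open>degree r \<le> N\<close> by (simp add: card_image inj_on_def)
  qed
  show ?thesis
  proof (rule that[of "\<lambda>i j. coeff (l j) i"])
    fix p :: "real poly" and i assume "degree p \<le> N"
    from arg_cong[OF interp[OF this], of "\<lambda>p. coeff p i"]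
    show "coeff p i = (\<Sum>j\<le>N. coeff (l j) i * poly p (real j))"
      by (simp add: coeff_sum mult.commute)
  qed
qed

text \<open>For fixed \<open>c\<close>, the coefficients of \<open>\<phi> a c\<close> as a
  polynomial in \<open>a\<close> are fixed linear combinations of the values
  \<open>\<phi> j c\<close> at the nodes, hence themselves polynomial in \<open>c\<close>; then
  \<open>c = a\<close> is inserted.\<close>

lemma poly_fun_le_diagonal:
  assumes 1: "\<And>c. c \<ge> 0 \<Longrightarrow> poly_fun_le N (\<lambda>a. \<phi> a c)"
    and 2: "\<And>a. a \<ge> 0 \<Longrightarrow> poly_fun_le M (\<lambda>c. \<phi> a c)"
  shows "poly_fun_le (N + M) (\<lambda>a. \<phi> a a)"
proof -
  obtain L :: "nat \<Rightarrow> nat \<Rightarrow> real"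
    where L: "\<And>p i. degree p \<le> N \<Longrightarrow> coeff p i = (\<Sum>j\<le>N. L i j * poly p (real j))"
    using lagrange_coefficients by blast
  have "\<phi> a a = (\<Sum>i\<le>N. a ^ i * (\<Sum>j\<le>N. L i j * \<phi> (real j) a))" if a: "a \<ge> 0" for a
  proof -
    obtain p where p: "degree p \<le> N" "\<And>b. b \<ge> 0 \<Longrightarrow> \<phi> b a = poly p b"
      using 1[OF a] unfolding poly_fun_le_def by auto
    have "\<phi> a a = (\<Sum>i\<le>N. coeff p i * a ^ i)"
      unfolding p(2)[OF a] poly_altdef
      by (rule sum.mono_neutral_left) (use p(1) in \<open>auto simp: coeff_eq_0\<close>)
    also have "\<dots> = (\<Sum>i\<le>N. a ^ i * (\<Sum>j\<le>N. L i j * \<phi> (real j) a))"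
      using p by (simp add: L[OF p(1)] mult.commute)
    finally show ?thesis .
  qed
  then have *: "poly_fun_le (N + M) (\<lambda>a. \<phi> a a) \<longleftrightarrow>
      poly_fun_le (N + M) (\<lambda>a. \<Sum>i\<le>N. a ^ i * (\<Sum>j\<le>N. L i j * \<phi> (real j) a))"
    by (intro poly_fun_le_cong)
  have "poly_fun_le (N + M) (\<lambda>a. a ^ i * (\<Sum>j\<le>N. L i j * \<phi> (real j) a))" if "i \<le> N" for i
    by (rule poly_fun_le_mono[OF poly_fun_le_power_mult])
       (use that in \<open>auto intro!: poly_fun_le_sum poly_fun_le_cmult 2\<close>)
  then show ?thesis unfolding * by (intro poly_fun_le_sum) auto
qed

section \<open>Polynomiality along maxima of affine functions\<close>

lemma Max_image_le_iff:
  fixes s :: "nat \<Rightarrow> real"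
  assumes "finite A" "A \<noteq> {}"
  shows "Max (s ` A) \<le> c \<longleftrightarrow> (\<forall>i\<in>A. s i \<le> c)"
  using assms by simp

lemma Max_image_ge:
  fixes s :: "nat \<Rightarrow> real"
  assumes "finite A" "i \<in> A"
  shows "s i \<le> Max (s ` A)"
  using assms by simp

text \<open>
  With \<open>s 0 = 0\<close> and \<open>s i = v 1 + \<dots> + v i\<close>, \<open>(a + b) * m k\<close> is the maximum of \<open>\<Sum>i. t i * v i\<close> over the
  simplex \<open>a + b \<ge> t 1 \<ge> \<dots> \<ge> t k \<ge> 0\<close>, and \<open>b * m i + a * R i\<close> is the maximum over its part
  \<open>t i \<ge> a \<ge> t (i + 1)\<close>. The lemma is the subdivision of the dilated simplex into these parts.
\<close>

lemma Max_cut: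
  fixes s :: "nat \<Rightarrow> real" and a b :: real and k :: nat
  defines "m \<equiv> \<lambda>i. Max (s ` {..i})" and "R \<equiv> \<lambda>i. Max (s ` {i..k})"
  defines "X \<equiv> \<lambda>j. Max ((\<lambda>i. b * m i + a * R i) ` {..j})"
  assumes a: "a \<ge> 0" and b: "b \<ge> 0"
  shows Max_cut_min: "Suc j \<le> k \<Longrightarrow> min (X j) (b * m (Suc j) + a * R (Suc j)) = b * m j + a * R (Suc j)"
    and Max_cut_max: "max (X j) (b * m (Suc j) + a * R (Suc j)) = X (Suc j)"
    and Max_cut_full: "X k = (a + b) * m k"
proof -
  show "max (X j) (b * m (Suc j) + a * R (Suc j)) = X (Suc j)"
    by (simp add: X_def atMost_Suc max.commute)
  have mSuc: "m (Suc j) = max (m j) (s (Suc j))" for j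
    by (simp add: m_def atMost_Suc max.commute)
  have mono: "m i \<le> m j" if "i \<le> j" for i j
    unfolding m_def by (intro Max_mono) (use that in auto)
  have anti: "R j \<le> R i" if "i \<le> j" "j \<le> k" for i j
    unfolding R_def by (intro Max_mono) (use that in auto)
  show "min (X j) (b * m (Suc j) + a * R (Suc j)) = b * m j + a * R (Suc j)" if j: "Suc j \<le> k"
  proof (rule antisym)
    have "b * m j + a * R (Suc j) \<le> b * m j + a * R j"
      using anti[of j "Suc j"] j a by (intro add_left_mono mult_left_mono) auto
    also have "\<dots> \<le> X j"
      unfolding X_def by (rule Max_image_ge) auto
    finally show "b * m j + a * R (Suc j) \<le> min (X j) (b * m (Suc j) + a * R (Suc j))"
      using mono[of j "Suc j"] b by (auto intro: mult_left_mono)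
    show "min (X j) (b * m (Suc j) + a * R (Suc j)) \<le> b * m j + a * R (Suc j)"
    \<comment> \<open>If \<open>s (Suc j)\<close> is no new maximum, then
      \<open>m (Suc j) = m j\<close> and the second argument of the minimum is already the bound.
      Otherwise \<open>s (Suc j)\<close> exceeds all earlier values, so
      \<open>R i \<le> R (Suc j)\<close> for \<open>i \<le> j\<close>, and the first argument is
      small enough.\<close>
    proof (cases "s (Suc j) \<le> m j")
      case True
      then show ?thesis by (simp add: mSuc max_absorb1)
    next
      case False
      have "R i \<le> R (Suc j)" if "i \<le> j" for i
      proof -
        have "s l \<le> R (Suc j)" if "l \<in> {i..k}" for l
        proof (cases "l \<le> j")
          case True
          then have "s l \<le> m j" unfolding m_def by (intro Max_image_ge) auto
          also have "\<dots> \<le> s (Suc j)" using False by simp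
          also have "\<dots> \<le> R (Suc j)" unfolding R_def using j by (intro Max_image_ge) auto
          finally show ?thesis .
        next
          case False
          then show ?thesis unfolding R_def using that by (intro Max_image_ge) auto
        qed
        then have "Max (s ` {i..k}) \<le> R (Suc j)"
          using \<open>i \<le> j\<close> j by (subst Max_image_le_iff) auto
        then show ?thesis by (simp add: R_def)
      qed
      then have "X j \<le> b * m j + a * R (Suc j)"
        unfolding X_def using a b mono
        by (subst Max_image_le_iff) (auto intro!: add_mono mult_left_mono)
      then show ?thesis by simp
    qed
  qed
  show "X k = (a + b) * m k"
  proof (rule antisym)
    have "b * m i + a * R i \<le> (a + b) * m k" if "i \<le> k" for i
    proof -
      have "R i \<le> m k" unfolding R_def m_def by (intro Max_mono) (use that in auto)
      then have "b * m i + a * R i \<le> b * m k + a * m k"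
        using mono[OF that] a b by (intro add_mono mult_left_mono)
      then show ?thesis by (simp add: algebra_simps)
    qed
    then show "X k \<le> (a + b) * m k"
      unfolding X_def by (subst Max_image_le_iff) auto
    have "m k \<in> s ` {..k}" unfolding m_def by (intro Max_in) auto
    then obtain i where i: "i \<le> k" "m k = s i" by auto
    have "s i \<le> m i" "s i \<le> R i"
      unfolding R_def m_def using i by (intro Max_image_ge; auto)+
    then have "b * s i + a * s i \<le> b * m i + a * R i"
      using a b by (intro add_mono mult_left_mono)
    also have "\<dots> \<le> X k" unfolding X_def using i by (intro Max_image_ge) auto
    finally show "(a + b) * m k \<le> X k" using i by (simp add: algebra_simps)
  qed
qed

lemma Conv_cd_Max_finite:
  assumes "finite A" "A \<noteq> {}" "\<And>i. i \<in> A \<Longrightarrow> f i \<in> Conv_cd"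
  shows "(\<lambda>x. Max ((\<lambda>i. f i x) ` A)) \<in> Conv_cd"
  using assms
proof (induction A rule: finite_ne_induct)
  case (insert i A)
  then have "(\<lambda>x. max (f i x) (Max ((\<lambda>i. f i x) ` A))) \<in> Conv_cd"
    by (intro Conv_cd_max) auto
  then show ?case using insert by simp
qed simp

lemma poly_fun_le_monomial:
  "poly_fun_le (\<Sum>b\<in>B. e b) (\<lambda>s. \<Prod>b\<in>B. (s * c b) ^ e b)"
proof -
  have "(\<lambda>s. \<Prod>b\<in>B. (s * c b) ^ e b) = (\<lambda>s. s ^ (\<Sum>b\<in>B. e b) * (\<Prod>b\<in>B. c b ^ e b))"
    by (simp add: power_mult_distrib prod.distrib power_sum)
  then show ?thesis
    using poly_fun_le_power_mult[OF poly_fun_le_const[of 0 "\<Prod>b\<in>B. c b ^ e b"]] by simp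
qed

lemma poly_fun_le_on_ray:
  assumes "polynomial_of_degree_le d p"
  shows "poly_fun_le d (\<lambda>s. p (s *\<^sub>R v))"
proof -
  obtain c where c: "\<And>v. p v = (\<Sum>m | m \<in> Basis \<rightarrow>\<^sub>E UNIV \<and> (\<Sum>b\<in>Basis. m b) \<le> d.
      c m * (\<Prod>b\<in>Basis. (v \<bullet> b) ^ m b))"
    using assms unfolding polynomial_of_degree_le_def by blast
  show ?thesis
    unfolding c inner_scaleR_left
    by (intro poly_fun_le_sum poly_fun_le_cmult poly_fun_le_mono[OF poly_fun_le_monomial]) auto
qed

lemma locally_uniform_limit_scale:
  fixes f G :: "'a::euclidean_space \<Rightarrow> real"
  assumes G: "continuous_on UNIV G" and a: "a \<longlonglongrightarrow> c"
  shows "locally_uniform_limit (\<lambda>k x. f x + a k * G x) (\<lambda>x. f x + c * G x)"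
proof (rule locally_uniform_limitI)
  fix r e :: real assume e: "e > 0"
  have "bounded (G ` cball 0 r)"
    by (intro compact_imp_bounded compact_continuous_image continuous_on_subset[OF G]) auto
  then obtain B where B: "B > 0" "\<And>x. x \<in> cball 0 r \<Longrightarrow> \<bar>G x\<bar> \<le> B"
    unfolding bounded_pos by auto
  have "\<forall>\<^sub>F k in sequentially. \<bar>a k - c\<bar> < e / B"
    using tendstoD[OF a, of "e / B"] e B(1) by (simp add: dist_real_def)
  then show "\<forall>\<^sub>F k in sequentially. \<forall>x\<in>cball 0 r. \<bar>f x + a k * G x - (f x + c * G x)\<bar> < e"
  proof eventually_elim
    case (elim k)
    show ?case
    proof
      fix x :: 'a assume "x \<in> cball 0 r"
      have "\<bar>f x + a k * G x - (f x + c * G x)\<bar> = \<bar>a k - c\<bar> * \<bar>G x\<bar>"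
        by (simp add: abs_mult[symmetric] algebra_simps)
      also have "\<dots> \<le> \<bar>a k - c\<bar> * B"
        using B(2)[OF \<open>x \<in> cball 0 r\<close>] by (intro mult_left_mono) auto
      also have "\<dots> < e" using elim B(1) by (simp add: field_simps)
      finally show "\<bar>f x + a k * G x - (f x + c * G x)\<bar> < e" .
    qed
  qed
qed

section \<open>Polynomial dependence of the valuation on the dilation factor\<close>

locale polynomial_valuation =
  fixes d :: nat and Z :: "('a::euclidean_space \<Rightarrow> real) \<Rightarrow> real"
  assumes cont: "continuous_map (subtopology epi_topology Conv_cd) euclideanreal Z"
    and val: "valuation_on Conv_cd Z"
    and pol: "polynomial_on d Conv_cd Z"
begin

lemma Z_tendsto:
  assumes "\<And>k. F k \<in> Conv_cd" "f \<in> Conv_cd" "locally_uniform_limit F f"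
  shows "(\<lambda>k. Z (F k)) \<longlonglongrightarrow> Z f"
  using continuous_map_epi_tendsto[OF cont Conv_cd_subset_Conv] assms .

lemma Z_max_min:
  assumes "f \<in> Conv_cd" "h \<in> Conv_cd" "(\<lambda>x. min (f x) (h x)) \<in> Conv_cd"
  shows "Z (\<lambda>x. max (f x) (h x)) = Z f + Z h - Z (\<lambda>x. min (f x) (h x))"
  using val assms Conv_cd_max[OF assms(1,2)] unfolding valuation_on_def by (simp add: algebra_simps)

lemma poly_fun_le_Z_affine:
  assumes "f \<in> Conv_cd"
  shows "poly_fun_le d (\<lambda>s. Z (\<lambda>x. f x + s * aff p x))"
proof -
  have "polynomial_of_degree_le d (\<lambda>(a, c). Z (\<lambda>x. f x + (a \<bullet> x + c)))"
    using pol assms by (simp add: polynomial_on_def)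
  from poly_fun_le_on_ray[OF this, of p] show ?thesis
    by (simp add: case_prod_beta aff_def algebra_simps)
qed

text \<open>Inclusion-exclusion over the subdivided simplex: the pieces are glued one at a time, and
  piece \<open>Suc j\<close> meets the union \<open>X j\<close> of the earlier ones exactly in
  \<open>b * m j + a * R (Suc j)\<close>. Adding \<open>f\<close> commutes with maxima and
  minima.\<close>

lemma Z_Max_cut:
  fixes p :: "nat \<Rightarrow> 'a \<times> real" and k :: nat
  defines "m \<equiv> \<lambda>i x. MAX l\<in>{..i}. aff (p l) x" and "R \<equiv> \<lambda>i x. MAX l\<in>{i..k}. aff (p l) x"
  assumes f: "f \<in> Conv_cd" and a: "a \<ge> 0" and b: "b \<ge> 0"
  shows "Z (\<lambda>x. f x + (a + b) * m k x) =
    (\<Sum>i\<le>k. Z (\<lambda>x. f x + b * m i x + a * R i x)) - (\<Sum>i<k. Z (\<lambda>x. f x + b * m i x + a * R (Suc i) x))"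
proof -
  define X where "X j x = (MAX i\<in>{..j}. b * m i x + a * R i x)" for j x
  have m: "m i \<in> Conv_cd" for i
    unfolding m_def by (intro Conv_cd_Max_finite aff_in_Conv_cd) auto
  have R: "R i \<in> Conv_cd" if "i \<le> k" for i
    unfolding R_def using that by (intro Conv_cd_Max_finite aff_in_Conv_cd) auto
  have W: "(\<lambda>x. b * m i x + a * R j x) \<in> Conv_cd" if "j \<le> k" for i j
    using that by (intro Conv_cd_add Conv_cd_scale m R a b)
  have X: "X j \<in> Conv_cd" if "j \<le> k" for j
    unfolding X_def using that by (intro Conv_cd_Max_finite W) auto
  have fW: "(\<lambda>x. f x + b * m i x + a * R j x) \<in> Conv_cd" if "j \<le> k" for i j
    using Conv_cd_add[OF f W[OF that]] by (simp add: add.assoc)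
  have fX: "(\<lambda>x. f x + X j x) \<in> Conv_cd" if "j \<le> k" for j
    using Conv_cd_add[OF f X[OF that]] .
  have "Z (\<lambda>x. f x + X j x) =
      (\<Sum>i\<le>j. Z (\<lambda>x. f x + b * m i x + a * R i x)) - (\<Sum>i<j. Z (\<lambda>x. f x + b * m i x + a * R (Suc i) x))"
    if "j \<le> k" for j
    using that
  proof (induction j)
    case 0
    show ?case by (simp add: X_def add.assoc)
  next
    case (Suc j)
    note cut = Max_cut_min[OF a b Suc.prems] Max_cut_max[OF a b]
    have mn: "min (f x + X j x) (f x + b * m (Suc j) x + a * R (Suc j) x) = f x + b * m j x + a * R (Suc j) x" for x
      using cut(1)[of "\<lambda>i. aff (p i) x"] unfolding X_def m_def R_def
      by (simp add: min_add_distrib_right[symmetric] add.assoc)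
    have mx: "max (f x + X j x) (f x + b * m (Suc j) x + a * R (Suc j) x) = f x + X (Suc j) x" for x
      using cut(2)[of "\<lambda>i. aff (p i) x" k j] unfolding X_def m_def R_def
      by (simp add: max_add_distrib_right[symmetric] add.assoc)
    have "Z (\<lambda>x. max (f x + X j x) (f x + b * m (Suc j) x + a * R (Suc j) x)) =
        Z (\<lambda>x. f x + X j x) + Z (\<lambda>x. f x + b * m (Suc j) x + a * R (Suc j) x) -
        Z (\<lambda>x. min (f x + X j x) (f x + b * m (Suc j) x + a * R (Suc j) x))"
      by (intro Z_max_min fX fW) (use Suc.prems fW in \<open>auto simp: mn\<close>)
    then show ?case
      unfolding mn mx using Suc by simp
  qed
  from this[of k] show ?thesis
    using Max_cut_full[OF a b, of "\<lambda>i. aff (p i) _" k] unfolding X_def m_def R_def by simp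
qed

lemma continuous_on_Z_scale:
  assumes "f \<in> Conv_cd" "G \<in> Conv_cd"
  shows "continuous_on {0..} (\<lambda>a. Z (\<lambda>x. f x + a * G x))"
  unfolding continuous_on_sequentially comp_def
  using assms Conv_cd_subset_Conv
  by (auto intro!: Z_tendsto locally_uniform_limit_scale Conv_cd_add Conv_cd_scale Conv_continuous)

text \<open>Strong induction on the number of affine functions, the case of a single one being
  polynomiality of \<open>Z\<close>. Each further function costs one degree for recovering a
  function from its differences and \<open>d\<close> degrees for restoring the affine part
  \<open>p 0\<close>, whence \<open>k * Suc d\<close>.\<close>

lemma poly_fun_le_Z_Max:
  fixes p :: "nat \<Rightarrow> 'a \<times> real"
  assumes "f \<in> Conv_cd"
  shows "poly_fun_le (d + k * Suc d) (\<lambda>a. Z (\<lambda>x. f x + a * (MAX l\<in>{..k}. aff (p l) x)))"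
  using assms
proof (induction k arbitrary: f p rule: less_induct)
  case (less k)
  show ?case
  proof (cases k)
    case 0
    then show ?thesis using poly_fun_le_Z_affine[OF less.prems, of "p 0"] by simp
  next
    case (Suc n)
    have zero: "poly_fun_le (Suc (d + n * Suc d)) (\<lambda>a. Z (\<lambda>x. f x + a * (MAX l\<in>{..k}. aff (q l) x)))"
      (is "poly_fun_le _ ?g")
      if q: "q 0 = 0" and f: "f \<in> Conv_cd" for q :: "nat \<Rightarrow> 'a \<times> real" and f
    proof (rule poly_fun_le_if_differences)
      have Mc: "(\<lambda>x. MAX l\<in>{..k}. aff (q l) x) \<in> Conv_cd"
        by (intro Conv_cd_Max_finite aff_in_Conv_cd) auto
      show "continuous_on {0..} ?g" by (rule continuous_on_Z_scale[OF f Mc])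
      fix b :: real assume b: "b \<ge> 0"
      define m where "m i x = (MAX l\<in>{..i}. aff (q l) x)" for i :: nat and x
      define R where "R i x = (MAX l\<in>{i..k}. aff (q l) x)" for i x
      have fm: "(\<lambda>x. f x + b * m i x) \<in> Conv_cd" for i
        unfolding m_def by (intro Conv_cd_add f Conv_cd_scale b Conv_cd_Max_finite aff_in_Conv_cd) auto
      have R: "poly_fun_le (d + n * Suc d) (\<lambda>a. Z (\<lambda>x. f x + b * m i x + a * R j x))"
        if j: "1 \<le> j" "j \<le> k" for i j
      proof -
        have "{j..k} = (\<lambda>l. l + j) ` {..k - j}"
          using j by (simp add: atMost_atLeast0 image_add_atLeastAtMost')
        then have "R j x = (MAX l\<in>{..k - j}. aff (q (l + j)) x)" for x
          by (simp add: R_def image_image)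
        moreover have "poly_fun_le (d + (k - j) * Suc d)
            (\<lambda>a. Z (\<lambda>x. f x + b * m i x + a * (MAX l\<in>{..k - j}. aff (q (l + j)) x)))"
          by (rule less.IH) (use fm j in auto)
        moreover have "d + (k - j) * Suc d \<le> d + n * Suc d"
          using j Suc by (intro add_left_mono mult_right_mono) auto
        ultimately show ?thesis by (simp add: poly_fun_le_mono del: mult_Suc_right)
      qed
      have eq: "?g (a + b) - ?g a = (\<Sum>i=1..k. Z (\<lambda>x. f x + b * m i x + a * R i x)) -
          (\<Sum>i<k. Z (\<lambda>x. f x + b * m i x + a * R (Suc i) x))" if a: "a \<ge> 0" for a
      proof -
        have "(\<Sum>i\<le>k. Z (\<lambda>x. f x + b * m i x + a * R i x)) =
            Z (\<lambda>x. f x + b * m 0 x + a * R 0 x) + (\<Sum>i=1..k. Z (\<lambda>x. f x + b * m i x + a * R i x))"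
          by (simp add: sum.atLeast_Suc_atMost atMost_atLeast0)
        \<comment> \<open>The normalization \<open>q 0 = 0\<close> acts here: \<open>m 0\<close>
          vanishes and \<open>R 0\<close> is the full maximum, so the first piece is
          \<open>?g a\<close> itself. In all remaining terms \<open>a\<close> multiplies a maximum
          over \<open>{j..k}\<close> with \<open>j \<ge> 1\<close>, and \<open>b * m i\<close> is
          absorbed into the base function.\<close>
        moreover have "Z (\<lambda>x. f x + b * m 0 x + a * R 0 x) = ?g a"
          by (simp add: m_def R_def q atMost_atLeast0)
        ultimately show ?thesis
          using Z_Max_cut[OF f a b, where k = k and p = q] unfolding m_def R_def by simp
      qed
      show "poly_fun_le (d + n * Suc d) (\<lambda>a. ?g (a + b) - ?g a)"
      proof (rule iffD2[OF poly_fun_le_cong])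
        show "poly_fun_le (d + n * Suc d) (\<lambda>a. (\<Sum>i=1..k. Z (\<lambda>x. f x + b * m i x + a * R i x)) -
            (\<Sum>i<k. Z (\<lambda>x. f x + b * m i x + a * R (Suc i) x)))"
          by (intro poly_fun_le_diff poly_fun_le_sum R) auto
      qed (rule eq)
    qed
    \<comment> \<open>Translating by \<open>p 0\<close> achieves the normalization. The removed part
      \<open>a * aff (p 0)\<close> gets a scaling parameter \<open>c\<close> of its own, and the two
      parameters are identified afterwards.\<close>
    define q where "q l = p l - p 0" for l
    have q0: "q 0 = 0" by (simp add: q_def)
    have "poly_fun_le (Suc (d + n * Suc d) + d)
        (\<lambda>a. Z (\<lambda>x. (f x + a * aff (p 0) x) + a * (MAX l\<in>{..k}. aff (q l) x)))"
    proof (rule poly_fun_le_diagonal[where \<phi> = "\<lambda>a c. Z (\<lambda>x. (f x + c * aff (p 0) x) + a * (MAX l\<in>{..k}. aff (q l) x))"])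
      fix c :: real assume c: "c \<ge> 0"
      have fc: "(\<lambda>x. f x + c * aff (p 0) x) \<in> Conv_cd"
        by (intro Conv_cd_add Conv_cd_scale aff_in_Conv_cd c less.prems)
      show "poly_fun_le (Suc (d + n * Suc d))
          (\<lambda>a. Z (\<lambda>x. (f x + c * aff (p 0) x) + a * (MAX l\<in>{..k}. aff (q l) x)))"
        using zero[of q, OF q0 fc] .
      have fc: "(\<lambda>x. f x + c * (MAX l\<in>{..k}. aff (q l) x)) \<in> Conv_cd"
        by (intro Conv_cd_add Conv_cd_scale Conv_cd_Max_finite aff_in_Conv_cd c less.prems) auto
      have "poly_fun_le d (\<lambda>a. Z (\<lambda>x. (f x + c * (MAX l\<in>{..k}. aff (q l) x)) + a * aff (p 0) x))"
        by (rule poly_fun_le_Z_affine[OF fc])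
      then show "poly_fun_le d (\<lambda>a. Z (\<lambda>x. (f x + a * aff (p 0) x) + c * (MAX l\<in>{..k}. aff (q l) x)))"
        by (simp add: add_ac)
    qed
    moreover have "(MAX l\<in>{..k}. aff (p l) x) = aff (p 0) x + (MAX l\<in>{..k}. aff (q l) x)" for x
    proof -
      have "(\<lambda>l. aff (p l) x) = (\<lambda>l. aff (q l) x + aff (p 0) x)"
        by (simp add: q_def aff_add[symmetric])
      moreover have "(MAX l\<in>{..k}. aff (q l) x + aff (p 0) x) = (MAX l\<in>{..k}. aff (q l) x) + aff (p 0) x"
        by (rule Max_add_commute) auto
      ultimately show ?thesis by (simp only: add.commute)
    qed
    ultimately show ?thesis using Suc by (simp add: algebra_simps)
  qed
qed

end

section \<open>Locality\<close>

text \<open>Separates the open strip below \<open>\<eta>\<close> over \<open>C\<close> from the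
  epigraph of \<open>f\<close>. The hyperplane is not vertical since the epigraph projects onto the
  whole space, and its last coefficient is not negative since the epigraph is unbounded upwards.
  Taking a ball for \<open>C\<close> gives a minorant that is large there; a singleton gives a
  supporting affine function.\<close>

lemma affine_sandwich:
  fixes f :: "'a::euclidean_space \<Rightarrow> real"
  assumes f: "convex_on UNIV f" and C: "convex C" "C \<noteq> {}" and le: "\<And>x. x \<in> C \<Longrightarrow> \<eta> \<le> f x"
  obtains p where "\<And>x. aff p x \<le> f x" "\<And>x. x \<in> C \<Longrightarrow> \<eta> \<le> aff p x"
proof -
  have "convex (C \<times> {..<\<eta>})" "C \<times> {..<\<eta>} \<noteq> {}"
    using C by (auto intro: convex_Times)
  moreover have "convex (epigraph UNIV f)" "epigraph UNIV f \<noteq> {}"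
    using f by (auto simp: convex_epigraph mem_epigraph) (auto simp: epigraph_def)
  moreover have "C \<times> {..<\<eta>} \<inter> epigraph UNIV f = {}"
    using le by (force simp: mem_epigraph)
  ultimately obtain a b where ab: "a \<noteq> 0" "\<forall>z\<in>C \<times> {..<\<eta>}. a \<bullet> z \<le> b" "\<forall>z\<in>epigraph UNIV f. a \<bullet> z \<ge> b"
    using separating_hyperplane_sets[of "C \<times> {..<\<eta>}" "epigraph UNIV f"] by blast
  obtain u \<alpha> where a: "a = (u, \<alpha>)" by (cases a)
  have nz: "u \<noteq> 0 \<or> \<alpha> \<noteq> 0" using ab(1) by (auto simp: a zero_prod_def)
  have low: "u \<bullet> x + \<alpha> * s \<le> b" if "x \<in> C" "s < \<eta>" for x s
    using bspec[OF ab(2), of "(x, s)"] that by (simp add: a)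
  have up: "b \<le> u \<bullet> x + \<alpha> * s" if "f x \<le> s" for x s
    using bspec[OF ab(3), of "(x, s)"] that by (simp add: a mem_epigraph)
  have "\<not> \<alpha> < 0"
  proof
    assume neg: "\<alpha> < 0"
    define s where "s = max (f 0) (b / \<alpha> + 1)"
    have "\<alpha> * s \<le> \<alpha> * (b / \<alpha> + 1)"
      using neg by (intro mult_left_mono_neg) (auto simp: s_def)
    also have "\<dots> < b" using neg by (simp add: distrib_left)
    finally show False using up[of 0 s] by (simp add: s_def)
  qed
  moreover have "\<alpha> \<noteq> 0"
  proof
    assume "\<alpha> = 0"
    with nz have "u \<noteq> 0" by simp
    then have "u \<bullet> (((b - 1) / (u \<bullet> u)) *\<^sub>R u) = b - 1" by simp
    with up[OF order_refl, of "((b - 1) / (u \<bullet> u)) *\<^sub>R u"] \<open>\<alpha> = 0\<close> show False by simp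
  qed
  ultimately have pos: "\<alpha> > 0" by simp
  define p where "p = ((- 1 / \<alpha>) *\<^sub>R u, b / \<alpha>)"
  have p: "aff p x = (b - u \<bullet> x) / \<alpha>" for x
    by (simp add: p_def aff_def diff_divide_distrib)
  show thesis
  proof (rule that)
    show "aff p x \<le> f x" for x
      using up[of x "f x"] pos by (simp add: p field_simps)
    show "\<eta> \<le> aff p x" if "x \<in> C" for x
    proof (rule dense_le)
      fix s assume "s < \<eta>"
      then show "s \<le> aff p x" using low[OF that, of s] pos by (simp add: p field_simps)
    qed
  qed
qed

lemma locally_uniform_limit_max:
  assumes "locally_uniform_limit F f" "locally_uniform_limit H h"
  shows "locally_uniform_limit (\<lambda>k x. max (F k x) (H k x)) (\<lambda>x. max (f x) (h x))"
proof (rule locally_uniform_limitI)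
  fix r e :: real assume "e > 0"
  from locally_uniform_limitD[OF assms(1) this] locally_uniform_limitD[OF assms(2) this]
  show "\<forall>\<^sub>F k in sequentially. \<forall>x\<in>cball 0 r. \<bar>max (F k x) (H k x) - max (f x) (h x)\<bar> < e"
    by eventually_elim (fastforce simp: max_def abs_if split: if_splits)
qed

lemma locally_uniform_limit_add:
  assumes "locally_uniform_limit F f" "locally_uniform_limit H h"
  shows "locally_uniform_limit (\<lambda>k x. F k x + H k x) (\<lambda>x. f x + h x)"
  using assms unfolding locally_uniform_limit_def by (auto intro: uniform_limit_add)

lemma locally_uniform_limit_const: "locally_uniform_limit (\<lambda>k. f) f"
  by (simp add: locally_uniform_limit_def uniform_limit_const)

lemma locally_uniform_limit_constants:
  assumes "c \<longlonglongrightarrow> c0"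
  shows "locally_uniform_limit (\<lambda>k x. c k) (\<lambda>x. c0)"
proof (rule locally_uniform_limitI)
  fix r e :: real assume "e > 0"
  from tendstoD[OF assms this]
  show "\<forall>\<^sub>F k in sequentially. \<forall>x\<in>cball 0 r. \<bar>c k - c0\<bar> < e"
    by eventually_elim (simp add: dist_real_def)
qed

lemma Max_aff_le:
  assumes "max_affine K f" "finite A" "A \<noteq> {}" "A \<subseteq> K"
  shows "(MAX p\<in>A. aff p x) \<le> f x"
proof -
  have "aff p x \<le> f x" if "p \<in> A" for p
    using assms(1,4) that unfolding max_affine_def by blast
  then show ?thesis using assms(2,3) by simp
qed

text \<open>A finite \<open>1 / (k + 1)\<close>-net of \<open>K\<close> suffices, because
  \<open>aff p x\<close> is Lipschitz in \<open>p\<close> with constant \<open>norm x + 1\<close>.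
  As the net lies in \<open>K\<close>, the approximation is from below.\<close>

lemma max_affine_approx:
  assumes K: "compact K" "max_affine K f"
  obtains A where "\<And>k. finite (A k)" "\<And>k. A k \<noteq> {}" "\<And>k. A k \<subseteq> K"
    "locally_uniform_limit (\<lambda>k x. MAX p\<in>A k. aff p x) f"
proof -
  have "\<exists>A\<subseteq>K. finite A \<and> K \<subseteq> (\<Union>p\<in>A. ball p (1 / (real k + 1)))" for k
  proof -
    have "K \<subseteq> (\<Union>p\<in>K. ball p (1 / (real k + 1)))" by auto
    then obtain A where "A \<subseteq> K" "finite A" "K \<subseteq> (\<Union>p\<in>A. ball p (1 / (real k + 1)))"
      using compactE_image[OF K(1), of K "\<lambda>p. ball p (1 / (real k + 1))"] by auto
    then show ?thesis by blast
  qed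
  then obtain A where A: "\<And>k. A k \<subseteq> K" "\<And>k. finite (A k)"
    "\<And>k. K \<subseteq> (\<Union>p\<in>A k. ball p (1 / (real k + 1)))" by metis
  have "K \<noteq> {}" using K(2) unfolding max_affine_def by blast
  then have ne: "A k \<noteq> {}" for k using A(3)[of k] by blast
  have bound: "\<bar>(MAX p\<in>A k. aff p x) - f x\<bar> \<le> (1 / (real k + 1)) * (norm x + 1)" for k x
  proof -
    obtain p where p: "p \<in> K" "f x = aff p x"
      using K(2) unfolding max_affine_def by blast
    then obtain q where q: "q \<in> A k" "p \<in> ball q (1 / (real k + 1))"
      using A(3) by blast
    have "aff p x - aff q x = aff (p - q) x" by (simp add: aff_def algebra_simps)
    also have "\<dots> \<le> norm (p - q) * (norm x + 1)" using abs_aff_le[of "p - q" x] by simp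
    also have "\<dots> \<le> (1 / (real k + 1)) * (norm x + 1)"
      using q(2) by (intro mult_right_mono) (auto simp: dist_norm norm_minus_commute)
    finally have "f x - aff q x \<le> (1 / (real k + 1)) * (norm x + 1)" using p by simp
    moreover have "aff q x \<le> (MAX p\<in>A k. aff p x)" using q(1) A(2) by simp
    moreover have "(MAX p\<in>A k. aff p x) \<le> f x"
      by (rule Max_aff_le[OF K(2) A(2) ne A(1)])
    ultimately show ?thesis by linarith
  qed
  have "locally_uniform_limit (\<lambda>k x. MAX p\<in>A k. aff p x) f"
  proof (rule locally_uniform_limitI)
    fix r e :: real assume e: "e > 0"
    have "(\<lambda>k. (1 / (real k + 1)) * (\<bar>r\<bar> + 1)) \<longlonglongrightarrow> 0"
      using tendsto_mult_left_zero[OF LIMSEQ_inverse_real_of_nat, of "\<bar>r\<bar> + 1"]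
      by (simp add: inverse_eq_divide add.commute)
    from order_tendstoD(2)[OF this e]
    show "\<forall>\<^sub>F k in sequentially. \<forall>x\<in>cball 0 r. \<bar>(MAX p\<in>A k. aff p x) - f x\<bar> < e"
    proof eventually_elim
      case (elim k)
      show ?case
      proof
        fix x :: 'a assume "x \<in> cball 0 r"
        then have "(1 / (real k + 1)) * (norm x + 1) \<le> (1 / (real k + 1)) * (\<bar>r\<bar> + 1)"
          by (intro mult_left_mono) auto
        then show "\<bar>(MAX p\<in>A k. aff p x) - f x\<bar> < e"
          using bound[of x k] elim by linarith
      qed
    qed
  qed
  with A ne show thesis using that by blast
qed

lemma finite_eq_image_atMost:
  assumes "finite A" "A \<noteq> {}"
  obtains p :: "nat \<Rightarrow> 'b" and k where "A = p ` {..k}"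
proof -
  obtain xs where xs: "set xs = A" using assms(1) finite_list by blast
  with assms(2) have "xs \<noteq> []" by auto
  then have "{..<length xs} = {..length xs - 1}" by (cases xs) auto
  with xs have "A = (!) xs ` {..length xs - 1}"
    using nth_image[of "length xs" xs] by (simp add: atLeast0LessThan)
  then show thesis using that by blast
qed

lemma poly_fun_le_eq_zero:
  assumes "poly_fun_le N g" "s0 > 0" "\<And>s. 0 \<le> s \<Longrightarrow> s \<le> s0 \<Longrightarrow> g s = 0" "a \<ge> 0"
  shows "g a = 0"
proof -
  obtain p where p: "\<And>a. a \<ge> 0 \<Longrightarrow> g a = poly p a"
    using assms(1) unfolding poly_fun_le_def by blast
  have "p = 0"
  proof (rule ccontr)
    assume "p \<noteq> 0"
    then have "finite {x. poly p x = 0}" by (rule poly_roots_finite)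
    moreover have "{0..s0} \<subseteq> {x. poly p x = 0}" using p assms(3) by force
    ultimately have "finite {0..s0}" by (rule rev_finite_subset)
    then show False using assms(2) by (simp add: infinite_Icc)
  qed
  then show ?thesis using p[OF assms(4)] by simp
qed

section \<open>From continuity at zero to dependence on a ball only\<close>

context polynomial_valuation
begin

text \<open>If no such pair existed, counterexamples for radius \<open>k + 1\<close> and tolerance
  \<open>1 / (k + 1)\<close> would converge to 0 locally uniformly, while their values stay away
  from \<open>Z 0\<close>.\<close>

lemma bounded_near_zero:
  obtains R \<delta> where "R > 0" "\<delta> > 0"
    "\<And>f. f \<in> Conv_cd \<Longrightarrow> (\<And>x. x \<in> cball 0 R \<Longrightarrow> \<bar>f x\<bar> \<le> \<delta>) \<Longrightarrow> \<bar>Z f - Z (\<lambda>x. 0)\<bar> < 1"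
proof (rule ccontr)
  assume neg: "\<not> thesis"
  have "\<exists>f. f \<in> Conv_cd \<and> (\<forall>x\<in>cball 0 (real k + 1). \<bar>f x\<bar> \<le> 1 / (real k + 1)) \<and> \<not> \<bar>Z f - Z (\<lambda>x. 0)\<bar> < 1" for k
    using neg that[of "real k + 1" "1 / (real k + 1)"] by force
  then obtain F where F: "\<And>k. F k \<in> Conv_cd" "\<And>k. \<not> \<bar>Z (F k) - Z (\<lambda>x. 0)\<bar> < 1"
    "\<And>k x. x \<in> cball 0 (real k + 1) \<Longrightarrow> \<bar>F k x\<bar> \<le> 1 / (real k + 1)" by metis
  have "locally_uniform_limit F (\<lambda>x. 0)"
  proof (rule locally_uniform_limitI)
    fix r e :: real assume "e > 0"
    have "(\<lambda>k. 1 / (real k + 1)) \<longlonglongrightarrow> 0"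
      using LIMSEQ_inverse_real_of_nat by (simp add: inverse_eq_divide add.commute)
    from order_tendstoD(2)[OF this \<open>e > 0\<close>] have "\<forall>\<^sub>F k in sequentially. 1 / (real k + 1) < e" .
    moreover have "\<forall>\<^sub>F k in sequentially. k \<ge> nat \<lceil>r\<rceil>" by (rule eventually_ge_at_top)
    ultimately show "\<forall>\<^sub>F k in sequentially. \<forall>x\<in>cball 0 r. \<bar>F k x - 0\<bar> < e"
    proof eventually_elim
      case (elim k)
      then have "r \<le> real k + 1" by linarith
      then have "\<bar>F k x\<bar> \<le> 1 / (real k + 1)" if "x \<in> cball 0 r" for x
        using that by (intro F(3)) auto
      then show ?case using elim(1) by force
    qed
  qed
  from tendstoD[OF Z_tendsto[OF F(1) Conv_cd_zero this], of 1]
  have "\<forall>\<^sub>F k in sequentially. False"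
    by (simp add: dist_real_def F(2))
  then show False by simp
qed

lemma vanishing_polyhedral:
  obtains R where "R > 0"
    "\<And>A p. finite A \<Longrightarrow> A \<noteq> {} \<Longrightarrow> (\<And>x. x \<in> cball 0 R \<Longrightarrow> (MAX q\<in>A. aff q x) = 0) \<Longrightarrow>
      Z (\<lambda>x. (MAX q\<in>A. aff q x) + aff p x) = Z (aff p)"
proof -
  obtain R \<delta> where R: "R > 0" "\<delta> > 0"
    "\<And>f. f \<in> Conv_cd \<Longrightarrow> (\<And>x. x \<in> cball 0 R \<Longrightarrow> \<bar>f x\<bar> \<le> \<delta>) \<Longrightarrow> \<bar>Z f - Z (\<lambda>x. 0)\<bar> < 1"
    using bounded_near_zero by blast
  show thesis
  proof (rule that[OF R(1)])
    fix A :: "('a \<times> real) set" and p :: "'a \<times> real"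
    assume A: "finite A" "A \<noteq> {}" and van: "\<And>x. x \<in> cball 0 R \<Longrightarrow> (MAX q\<in>A. aff q x) = 0"
    define G where "G x = (MAX q\<in>A. aff q x)" for x
    have G: "G \<in> Conv_cd"
      unfolding G_def using Conv_cd_Max_finite[OF A, of aff] aff_in_Conv_cd by blast
    \<comment> \<open>On the ball \<open>aff p + a * G\<close> equals \<open>aff p\<close>, which is
      at most \<open>\<delta>\<close> in absolute value, so the bound near 0 applies for every
      \<open>a \<ge> 0\<close>. The constant polynomial is then compared at \<open>a = 0\<close> and
      \<open>a = 1\<close>.\<close>
    have small: "Z (\<lambda>x. G x + aff p x) = Z (aff p)" if p: "norm p * (R + 1) \<le> \<delta>" for p
    proof -
      obtain q and k :: nat where "A = q ` {..k}" using finite_eq_image_atMost[OF A] by blast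
      then have Gq: "G x = (MAX l\<in>{..k}. aff (q l) x)" for x
        by (simp add: G_def image_image)
      obtain g where g: "\<And>a. a \<ge> 0 \<Longrightarrow> Z (\<lambda>x. aff p x + a * G x) = poly g a"
        using poly_fun_le_Z_Max[OF aff_in_Conv_cd[of p], of k q] unfolding poly_fun_le_def Gq by blast
      have "\<bar>poly g a\<bar> \<le> \<bar>Z (\<lambda>x. 0)\<bar> + 1" if a: "a \<ge> 0" for a
      proof -
        have "\<bar>Z (\<lambda>x. aff p x + a * G x) - Z (\<lambda>x. 0)\<bar> < 1"
        proof (rule R(3))
          show "(\<lambda>x. aff p x + a * G x) \<in> Conv_cd"
            by (intro Conv_cd_add Conv_cd_scale aff_in_Conv_cd G a)
          fix x :: 'a assume x: "x \<in> cball 0 R"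
          have "\<bar>aff p x\<bar> \<le> norm p * (norm x + 1)" by (rule abs_aff_le)
          also have "\<dots> \<le> norm p * (R + 1)" using x by (intro mult_left_mono) auto
          finally show "\<bar>aff p x + a * G x\<bar> \<le> \<delta>" using p van[OF x] by (simp add: G_def)
        qed
        then show ?thesis using g[OF a] by linarith
      qed
      from poly_bounded_constant[OF this, where a = 1] show ?thesis
        using g[of 0] g[of 1] by (simp add: add.commute)
    qed
    \<comment> \<open>For \<open>s \<le> s0\<close> the function \<open>s * aff p\<close> meets the
      smallness condition; the summand 1 keeps the denominator positive when \<open>p = 0\<close>. A
      polynomial in \<open>s\<close> vanishing on \<open>[0, s0]\<close> then vanishes at
      \<open>s = 1\<close>.\<close>
    define s0 where "s0 = \<delta> / (norm p * (R + 1) + 1)"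
    have den: "norm p * (R + 1) + 1 > 0" using R(1) by (intro add_nonneg_pos mult_nonneg_nonneg) auto
    have "Z (\<lambda>x. G x + 1 * aff p x) - Z (\<lambda>x. 0 + 1 * aff p x) = 0"
    proof (rule poly_fun_le_eq_zero[where g = "\<lambda>s. Z (\<lambda>x. G x + s * aff p x) - Z (\<lambda>x. 0 + s * aff p x)" and a = 1])
      show "poly_fun_le d (\<lambda>s. Z (\<lambda>x. G x + s * aff p x) - Z (\<lambda>x. 0 + s * aff p x))"
        by (intro poly_fun_le_diff poly_fun_le_Z_affine G Conv_cd_zero)
      show "s0 > 0" using R(2) den by (simp add: s0_def)
      fix s :: real assume s: "0 \<le> s" "s \<le> s0"
      have "norm (s *\<^sub>R p) * (R + 1) = s * (norm p * (R + 1))" using s by simp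
      also have "\<dots> \<le> s * (norm p * (R + 1) + 1)" using s by (intro mult_left_mono) auto
      also have "\<dots> \<le> s0 * (norm p * (R + 1) + 1)" using s den by (intro mult_right_mono) auto
      also have "\<dots> = \<delta>" using den by (simp add: s0_def)
      finally have "Z (\<lambda>x. G x + aff (s *\<^sub>R p) x) = Z (aff (s *\<^sub>R p))" by (rule small)
      then show "Z (\<lambda>x. G x + s * aff p x) - Z (\<lambda>x. 0 + s * aff p x) = 0"
        by (simp add: aff_scaleR[abs_def])
    qed simp
    then show "Z (\<lambda>x. (MAX q\<in>A. aff q x) + aff p x) = Z (aff p)"
      by (simp add: G_def)
  qed
qed

text \<open>Only affine functions are perturbed here, and only by nonnegative \<open>G\<close>.
  Agreement of \<open>Z\<close> on arbitrary functions that coincide on the ball is derived from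
  this.\<close>

definition local_radius :: "real \<Rightarrow> bool" where
  "local_radius R \<longleftrightarrow> R > 0 \<and>
     (\<forall>G\<in>Conv_cd. \<forall>p. (\<forall>x. 0 \<le> G x) \<longrightarrow> (\<forall>x\<in>cball 0 R. G x = 0) \<longrightarrow> Z (\<lambda>x. G x + aff p x) = Z (aff p))"

text \<open>Polyhedral approximations of \<open>G\<close> from below may be negative on the ball.
  Inserting the affine function 0 makes them vanish there exactly, and since
  \<open>G \<ge> 0\<close> the limit is still \<open>G\<close>.\<close>

lemma ex_local_radius: "\<exists>R. local_radius R"
proof -
  obtain R where R: "R > 0"
    "\<And>A p. finite A \<Longrightarrow> A \<noteq> {} \<Longrightarrow> (\<And>x. x \<in> cball 0 R \<Longrightarrow> (MAX q\<in>A. aff q x) = 0) \<Longrightarrow>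
      Z (\<lambda>x. (MAX q\<in>A. aff q x) + aff p x) = Z (aff p)"
    using vanishing_polyhedral by blast
  have "Z (\<lambda>x. G x + aff p x) = Z (aff p)"
    if G: "G \<in> Conv_cd" "\<And>x. 0 \<le> G x" "\<And>x. x \<in> cball 0 R \<Longrightarrow> G x = 0" for G p
  proof -
    obtain K where K: "compact K" "max_affine K G" using G(1) by (rule Conv_cdE)
    obtain A where A: "\<And>k. finite (A k)" "\<And>k. A k \<noteq> {}" "\<And>k. A k \<subseteq> K"
      and lim: "locally_uniform_limit (\<lambda>k x. MAX p\<in>A k. aff p x) G"
      using max_affine_approx[OF K] by metis
    have mx: "(MAX q\<in>insert 0 (A k). aff q x) = max 0 (MAX q\<in>A k. aff q x)" for k x
      using A by simp
    have "locally_uniform_limit (\<lambda>k x. max 0 (MAX q\<in>A k. aff q x) + aff p x) (\<lambda>x. max 0 (G x) + aff p x)"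
      by (intro locally_uniform_limit_add locally_uniform_limit_max locally_uniform_limit_const lim)
    then have lim': "locally_uniform_limit (\<lambda>k x. (MAX q\<in>insert 0 (A k). aff q x) + aff p x) (\<lambda>x. G x + aff p x)"
      using G(2) by (simp only: mx max_absorb2)
    have in_cd: "(\<lambda>x. MAX q\<in>insert 0 (A k). aff q x) \<in> Conv_cd" for k
      using Conv_cd_Max_finite[of "insert 0 (A k)" aff] A aff_in_Conv_cd by blast
    have "(\<lambda>k. Z (\<lambda>x. (MAX q\<in>insert 0 (A k). aff q x) + aff p x)) \<longlonglongrightarrow> Z (\<lambda>x. G x + aff p x)"
      by (intro Z_tendsto lim' Conv_cd_add in_cd aff_in_Conv_cd G)
    moreover have "Z (\<lambda>x. (MAX q\<in>insert 0 (A k). aff q x) + aff p x) = Z (aff p)" for k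
    proof (rule R(2))
      fix x :: 'a assume x: "x \<in> cball 0 R"
      have "(MAX q\<in>A k. aff q x) \<le> 0"
        using Max_aff_le[OF K(2) A(1,2,3), of x k] G(3)[OF x] by simp
      then show "(MAX q\<in>insert 0 (A k). aff q x) = 0" unfolding mx by simp
    qed (use A in auto)
    ultimately show ?thesis by (simp add: LIMSEQ_const_iff)
  qed
  with R(1) show ?thesis unfolding local_radius_def by blast
qed

text \<open>
  An affine minorant of \<open>f - aff p\<close> that is positive on the ball, scaled up, gives an affine \<open>aff c\<close> that
  dominates \<open>f\<close> on the ball and lies below \<open>f\<close> wherever \<open>f < aff p\<close>. So \<open>f\<close> is the minimum of
  \<open>f \<or> aff p\<close> and \<open>f \<or> aff c\<close>, while \<open>f \<or> aff c\<close> and \<open>f \<or> aff p \<or> aff c\<close> equal \<open>aff c\<close> on the ball.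
\<close>

lemma Z_max_aff_eq:
  assumes R: "local_radius R" and f: "f \<in> Conv_cd" and less: "\<And>x. x \<in> cball 0 R \<Longrightarrow> aff p x < f x"
  shows "Z (\<lambda>x. max (f x) (aff p x)) = Z f"
proof -
  define g where "g x = f x + aff (- p) x" for x
  have g: "g x = f x - aff p x" for x by (simp add: g_def aff_minus)
  have gcd: "g \<in> Conv_cd" unfolding g_def using Conv_cd_add_aff[OF f] by blast
  then have gc: "convex_on UNIV g" using Conv_cd_subset_Conv by (auto simp: Conv_def)
  have cont: "continuous_on (cball 0 R) g" using gcd Conv_cd_subset_Conv Conv_continuous by blast
  have ne: "cball (0::'a) R \<noteq> {}" and R0: "R > 0" using R by (auto simp: local_radius_def)
  obtain y where y: "y \<in> cball 0 R" "\<And>x. x \<in> cball 0 R \<Longrightarrow> g y \<le> g x"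
    using continuous_attains_inf[OF compact_cball ne cont] by blast
  obtain z where z: "z \<in> cball 0 R" "\<And>x. x \<in> cball 0 R \<Longrightarrow> g x \<le> g z"
    using continuous_attains_sup[OF compact_cball ne cont] by blast
  have pos: "g y > 0" using less[OF y(1)] by (simp add: g)
  obtain q where q: "\<And>x. aff q x \<le> g x" "\<And>x. x \<in> cball 0 R \<Longrightarrow> g y \<le> aff q x"
    using affine_sandwich[OF gc convex_cball ne y(2)] by blast
  \<comment> \<open>Ratio of the maximum to the minimum of \<open>g\<close> on the ball:
    \<open>aff q \<ge> g y\<close> becomes \<open>\<mu> * aff q \<ge> g z\<close> there. Since
    \<open>\<mu> \<ge> 1\<close>, negative values of \<open>aff q\<close> are only pushed further
    down.\<close>
  define \<mu> where "\<mu> = g z / g y"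
  have \<mu>: "\<mu> \<ge> 1" using y(2)[OF z(1)] pos by (simp add: \<mu>_def)
  define c where "c = \<mu> *\<^sub>R q + p"
  have c: "aff c x = \<mu> * aff q x + aff p x" for x by (simp add: c_def aff_add aff_scaleR)
  have on_ball: "f x \<le> aff c x" "aff p x \<le> aff c x" if x: "x \<in> cball 0 R" for x
  proof -
    have "g z = \<mu> * g y" using pos by (simp add: \<mu>_def)
    also have "\<dots> \<le> \<mu> * aff q x" using q(2)[OF x] \<mu> by (intro mult_left_mono) auto
    finally show "f x \<le> aff c x" using z(2)[OF x] by (simp add: c g)
    then show "aff p x \<le> aff c x" using less[OF x] by simp
  qed
  have mn: "min (max (f x) (aff p x)) (max (f x) (aff c x)) = f x" for x
  proof (cases "aff p x \<le> f x")
    case False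
    then have "g x < 0" by (simp add: g)
    then have "aff q x < 0" using q(1)[of x] by simp
    then have "\<mu> * aff q x \<le> 1 * aff q x" using \<mu> by (intro mult_right_mono_neg) auto
    then have "aff c x \<le> f x" using q(1)[of x] by (simp add: c g)
    then show ?thesis by simp
  qed simp
  have fa: "(\<lambda>x. max (f x) (aff p x)) \<in> Conv_cd" "(\<lambda>x. max (f x) (aff c x)) \<in> Conv_cd"
    by (intro Conv_cd_max f aff_in_Conv_cd)+
  have eq: "Z h = Z (aff c)"
    if h: "h \<in> Conv_cd" "\<And>x. aff c x \<le> h x" "\<And>x. x \<in> cball 0 R \<Longrightarrow> h x = aff c x" for h
  proof -
    have van: "Z (\<lambda>x. G x + aff c x) = Z (aff c)"
      if "G \<in> Conv_cd" "\<forall>x. 0 \<le> G x" "\<forall>x\<in>cball 0 R. G x = 0" for G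
      using R that unfolding local_radius_def by blast
    have "Z (\<lambda>x. (h x + aff (- c) x) + aff c x) = Z (aff c)"
      by (rule van[OF Conv_cd_add_aff[OF h(1)]]) (use h(2,3) in \<open>auto simp: aff_minus\<close>)
    then show ?thesis by (simp add: aff_minus)
  qed
  have "Z (\<lambda>x. max (max (f x) (aff p x)) (max (f x) (aff c x))) =
      Z (\<lambda>x. max (f x) (aff p x)) + Z (\<lambda>x. max (f x) (aff c x)) - Z f"
    using Z_max_min[OF fa] f by (simp add: mn)
  moreover have "Z (\<lambda>x. max (max (f x) (aff p x)) (max (f x) (aff c x))) = Z (aff c)"
    by (rule eq) (use Conv_cd_max[OF fa] on_ball in auto)
  moreover have "Z (\<lambda>x. max (f x) (aff c x)) = Z (aff c)"
    by (rule eq) (use fa on_ball in auto)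
  ultimately show ?thesis by simp
qed

text \<open>The affine functions are joined one at a time; the strict inequality on the ball
  survives because each maximum only raises the base function.\<close>

lemma Z_max_polyhedral_eq:
  assumes R: "local_radius R" and "finite A" "A \<noteq> {}" and f: "f \<in> Conv_cd"
    and less: "\<And>p x. p \<in> A \<Longrightarrow> x \<in> cball 0 R \<Longrightarrow> aff (c p) x < f x"
  shows "Z (\<lambda>x. max (f x) (MAX p\<in>A. aff (c p) x)) = Z f"
  using assms(2,3) less
proof (induction A rule: finite_ne_induct)
  case (singleton p)
  then show ?case using Z_max_aff_eq[OF R f, of "c p"] by simp
next
  case (insert p A)
  let ?h = "\<lambda>x. max (f x) (MAX p\<in>A. aff (c p) x)"
  have "(\<lambda>x. MAX p\<in>A. aff (c p) x) \<in> Conv_cd"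
    using Conv_cd_Max_finite[OF insert(1,2), of "\<lambda>p. aff (c p)"] aff_in_Conv_cd by blast
  then have h: "?h \<in> Conv_cd" by (intro Conv_cd_max f)
  have "Z (\<lambda>x. max (?h x) (aff (c p) x)) = Z ?h"
    by (rule Z_max_aff_eq[OF R h]) (use insert.prems in \<open>auto simp: less_max_iff_disj\<close>)
  moreover have "max (?h x) (aff (c p) x) = max (f x) (MAX p\<in>insert p A. aff (c p) x)" for x
    using insert(1,2) by (simp add: max.commute max.left_commute)
  moreover have "Z ?h = Z f" by (rule insert.IH) (use insert.prems in auto)
  ultimately show ?case by simp
qed

text \<open>The affine functions in \<open>K\<close> are only weakly below \<open>g = f\<close> on
  the ball. Lowering them by \<open>\<epsilon> k\<close> makes the inequality strict, and the shift
  disappears in the limit.\<close>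

lemma Z_max_eq_if_eq_on_ball:
  assumes R: "local_radius R" and f: "f \<in> Conv_cd" and g: "g \<in> Conv_cd"
    and eq: "\<And>x. x \<in> cball 0 R \<Longrightarrow> f x = g x"
  shows "Z (\<lambda>x. max (f x) (g x)) = Z f"
proof -
  obtain K where K: "compact K" "max_affine K g" using g by (rule Conv_cdE)
  obtain A where A: "\<And>k. finite (A k)" "\<And>k. A k \<noteq> {}" "\<And>k. A k \<subseteq> K"
    and lim: "locally_uniform_limit (\<lambda>k x. MAX p\<in>A k. aff p x) g"
    using max_affine_approx[OF K] by metis
  define \<epsilon> where "\<epsilon> k = inverse (real (Suc k))" for k
  define c where "c k p = p - (0, \<epsilon> k)" for k and p :: "'a \<times> real"
  have c: "aff (c k p) x = aff p x + - \<epsilon> k" for k p x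
    by (simp add: c_def aff_def)
  have "\<epsilon> \<longlonglongrightarrow> 0" unfolding \<epsilon>_def by (rule LIMSEQ_inverse_real_of_nat)
  then have \<epsilon>: "(\<lambda>k. - \<epsilon> k) \<longlonglongrightarrow> 0" using tendsto_minus by fastforce
  have "locally_uniform_limit (\<lambda>k x. (MAX p\<in>A k. aff p x) + - \<epsilon> k) (\<lambda>x. g x + 0)"
    by (intro locally_uniform_limit_add lim locally_uniform_limit_constants \<epsilon>)
  moreover have "(MAX p\<in>A k. aff p x) + - \<epsilon> k = (MAX p\<in>A k. aff (c k p) x)" for k x
    unfolding c by (rule Max_add_commute[symmetric]) (use A in auto)
  ultimately have "locally_uniform_limit (\<lambda>k x. MAX p\<in>A k. aff (c k p) x) g"
    by simp
  then have lim': "locally_uniform_limit (\<lambda>k x. max (f x) (MAX p\<in>A k. aff (c k p) x)) (\<lambda>x. max (f x) (g x))"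
    by (intro locally_uniform_limit_max locally_uniform_limit_const)
  have in_cd: "(\<lambda>x. MAX p\<in>A k. aff (c k p) x) \<in> Conv_cd" for k
    using Conv_cd_Max_finite[of "A k" "\<lambda>p. aff (c k p)"] A aff_in_Conv_cd by blast
  have "(\<lambda>k. Z (\<lambda>x. max (f x) (MAX p\<in>A k. aff (c k p) x))) \<longlonglongrightarrow> Z (\<lambda>x. max (f x) (g x))"
    by (intro Z_tendsto lim' Conv_cd_max in_cd f g)
  moreover have "Z (\<lambda>x. max (f x) (MAX p\<in>A k. aff (c k p) x)) = Z f" for k
  proof (rule Z_max_polyhedral_eq[OF R A(1,2) f])
    fix p x assume "p \<in> A k" "x \<in> cball (0::'a) R"
    then have "aff p x \<le> f x" using A(3) K(2) eq unfolding max_affine_def by (metis subsetD)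
    moreover have "\<epsilon> k > 0" by (simp add: \<epsilon>_def)
    ultimately show "aff (c k p) x < f x" by (simp add: c)
  qed
  ultimately show ?thesis by (simp add: LIMSEQ_const_iff)
qed

text \<open>Both values equal that of the maximum of \<open>f\<close> and \<open>g\<close>, which is
  symmetric; the minimum of \<open>f\<close> and \<open>g\<close> need not be convex and is
  avoided.\<close>

lemma Z_eq_if_eq_on_ball:
  assumes "local_radius R" "f \<in> Conv_cd" "g \<in> Conv_cd" "\<And>x. x \<in> cball 0 R \<Longrightarrow> f x = g x"
  shows "Z f = Z g"
  using Z_max_eq_if_eq_on_ball[of R f g] Z_max_eq_if_eq_on_ball[of R g f] assms
  by (simp add: max.commute)

end

section \<open>Lipschitz regularization\<close>

lemma convex_on_imp_lipschitz:
  fixes f :: "'a::euclidean_space \<Rightarrow> real"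
  assumes f: "convex_on UNIV f" and B: "\<And>x. x \<in> cball 0 (r + 1) \<Longrightarrow> \<bar>f x\<bar> \<le> B"
    and x: "x \<in> cball 0 r" and y: "y \<in> cball 0 r"
  shows "\<bar>f x - f y\<bar> \<le> 2 * B * norm (x - y)"
proof -
  have one: "f y - f x \<le> 2 * B * norm (x - y)" if x: "x \<in> cball 0 r" and y: "y \<in> cball 0 r" for x y
  proof (cases "x = y")
    case False
    define s where "s = norm (x - y)"
    \<comment> \<open>The segment from \<open>x\<close> through \<open>y\<close> is prolonged by
      length 1, which stays in the ball of radius \<open>r + 1\<close>; \<open>t\<close> is the
      weight with \<open>y = (1 - t) x + t z\<close>.\<close>
    define z where "z = y + (1 / s) *\<^sub>R (y - x)"
    define t where "t = s / (1 + s)"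
    have s: "s > 0" using False by (simp add: s_def)
    have t: "0 \<le> t" "t \<le> 1" "t \<le> s" using s by (auto simp: t_def field_simps)
    have "norm z \<le> norm y + norm ((1 / s) *\<^sub>R (y - x))" unfolding z_def by (rule norm_triangle_ineq)
    also have "norm ((1 / s) *\<^sub>R (y - x)) = 1" using s by (simp add: s_def norm_minus_commute)
    finally have z: "z \<in> cball 0 (r + 1)" using y by simp
    have "(1 + s) *\<^sub>R ((1 - t) *\<^sub>R x + t *\<^sub>R z) = ((1 + s) * (1 - t)) *\<^sub>R x + ((1 + s) * t) *\<^sub>R z"
      by (simp add: scaleR_add_right)
    also have "(1 + s) * (1 - t) = 1" using s by (simp add: t_def field_simps)
    also have "(1 + s) * t = s" using s by (simp add: t_def)
    also have "1 *\<^sub>R x + s *\<^sub>R z = (1 + s) *\<^sub>R y"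
      using s by (simp add: z_def algebra_simps)
    finally have "y = (1 - t) *\<^sub>R x + t *\<^sub>R z" using s by simp
    then have "f y \<le> (1 - t) * f x + t * f z"
      using convex_onD[OF f t(1,2), of x z] by simp
    then have "f y - f x \<le> t * (f z - f x)" by (simp add: algebra_simps)
    also have "\<dots> \<le> t * (2 * B)"
      using B[OF z] B[of x] x t by (intro mult_left_mono) auto
    also have "\<dots> \<le> s * (2 * B)"
      using t B[OF z] by (intro mult_right_mono) auto
    finally show ?thesis by (simp add: s_def mult.commute)
  qed simp
  from one[OF x y] one[OF y x] show ?thesis by (simp add: norm_minus_commute abs_le_iff)
qed

lemma Conv_bounded_on_cball:
  assumes "f \<in> Conv"
  obtains B where "B \<ge> 0" "\<And>x. x \<in> cball 0 r \<Longrightarrow> \<bar>f x\<bar> \<le> B"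
proof -
  have "bounded (f ` cball 0 r)"
    by (intro compact_imp_bounded compact_continuous_image Conv_continuous assms compact_cball)
  then obtain B where "B > 0" "\<forall>y\<in>f ` cball 0 r. norm y \<le> B" unfolding bounded_pos by blast
  then show thesis using that[of B] by simp
qed

text \<open>The Pasch-Hausdorff envelope of \<open>f\<close> restricted to the ball; where that
  restriction is \<open>L\<close>-Lipschitz it is the McShane extension.\<close>

definition lip_reg :: "real \<Rightarrow> real \<Rightarrow> ('a::euclidean_space \<Rightarrow> real) \<Rightarrow> 'a \<Rightarrow> real" where
  "lip_reg R L f x = (INF y\<in>cball 0 R. f y + L * norm (x - y))"

lemma lip_reg_attained:
  assumes f: "f \<in> Conv" and R: "R > 0"
  obtains y where "y \<in> cball 0 R" "lip_reg R L f x = f y + L * norm (x - y)"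
    "\<And>z. z \<in> cball 0 R \<Longrightarrow> lip_reg R L f x \<le> f z + L * norm (x - z)"
proof -
  have "continuous_on (cball 0 R) (\<lambda>y. f y + L * norm (x - y))"
    by (intro continuous_intros Conv_continuous f)
  moreover have "cball (0::'a) R \<noteq> {}" using R by simp
  ultimately obtain y where y: "y \<in> cball 0 R"
    "\<And>z. z \<in> cball 0 R \<Longrightarrow> f y + L * norm (x - y) \<le> f z + L * norm (x - z)"
    using continuous_attains_inf[OF compact_cball] by blast
  have "lip_reg R L f x = f y + L * norm (x - y)"
    unfolding lip_reg_def by (rule cInf_eq_minimum) (use y in auto)
  with y show thesis using that by auto
qed

lemma lip_reg_le:
  assumes "f \<in> Conv" "R > 0" "z \<in> cball 0 R"
  shows "lip_reg R L f x \<le> f z + L * norm (x - z)"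
  using lip_reg_attained[OF assms(1,2)] assms(3) by metis

lemma lip_reg_Conv:
  assumes f: "f \<in> Conv" and R: "R > 0" and L: "L \<ge> 0"
  shows "lip_reg R L f \<in> Conv"
proof -
  have "convex_on UNIV (lip_reg R L f)"
  proof (rule convex_onI)
    fix t :: real and u v :: 'a assume t: "0 < t" "t < 1"
    obtain y where y: "y \<in> cball 0 R" "lip_reg R L f u = f y + L * norm (u - y)"
      using lip_reg_attained[OF f R] by metis
    obtain z where z: "z \<in> cball 0 R" "lip_reg R L f v = f z + L * norm (v - z)"
      using lip_reg_attained[OF f R] by metis
    let ?w = "(1 - t) *\<^sub>R y + t *\<^sub>R z"
    have w: "?w \<in> cball 0 R"
      by (rule convexD[OF convex_cball]) (use y z t in auto)
    have "((1 - t) *\<^sub>R u + t *\<^sub>R v) - ?w = (1 - t) *\<^sub>R (u - y) + t *\<^sub>R (v - z)"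
      by (simp add: algebra_simps)
    then have nrm: "norm (((1 - t) *\<^sub>R u + t *\<^sub>R v) - ?w) \<le> (1 - t) * norm (u - y) + t * norm (v - z)"
      using norm_triangle_ineq[of "(1 - t) *\<^sub>R (u - y)" "t *\<^sub>R (v - z)"] t by simp
    have "lip_reg R L f ((1 - t) *\<^sub>R u + t *\<^sub>R v) \<le> f ?w + L * norm (((1 - t) *\<^sub>R u + t *\<^sub>R v) - ?w)"
      by (rule lip_reg_le[OF f R w])
    also have "\<dots> \<le> ((1 - t) * f y + t * f z) + L * ((1 - t) * norm (u - y) + t * norm (v - z))"
      using convex_onD[of UNIV f t y z] f t L nrm by (intro add_mono mult_left_mono) (auto simp: Conv_def)
    finally show "lip_reg R L f ((1 - t) *\<^sub>R u + t *\<^sub>R v) \<le> (1 - t) * lip_reg R L f u + t * lip_reg R L f v"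
      by (simp add: y z algebra_simps)
  qed simp
  then show ?thesis by (simp add: Conv_def)
qed

lemma lip_reg_Conv_cd:
  assumes f: "f \<in> Conv" and R: "R > 0" and L: "L \<ge> 0"
  shows "lip_reg R L f \<in> Conv_cd"
proof -
  define g where "g = lip_reg R L f"
  have gc: "convex_on UNIV g" using lip_reg_Conv[OF assms] by (simp add: g_def Conv_def)
  obtain M where M: "\<And>x. x \<in> cball 0 R \<Longrightarrow> \<bar>f x\<bar> \<le> M"
    using Conv_bounded_on_cball[OF f] by blast
  \<comment> \<open>Bounds the offset of a supporting affine function of slope at most
    \<open>L\<close>: evaluation at 0 gives \<open>g 0\<close> from above, and a minimizing point
    \<open>y\<close> of the ball gives \<open>- M - L * R\<close> from below.\<close>
  define T where "T = \<bar>g 0\<bar> + M + L * R"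
  define K where "K = {p. norm (fst p) \<le> L \<and> \<bar>snd p\<bar> \<le> T \<and> (\<forall>x. aff p x \<le> g x)}"
  have "closed K"
    unfolding K_def aff_def
    by (intro closed_Collect_conj closed_Collect_all closed_Collect_le continuous_intros)
  moreover have "bounded K"
  proof (rule boundedI)
    fix p assume p: "p \<in> K"
    have "norm p \<le> norm (fst p) + norm (snd p)" using norm_Pair_le[of "fst p" "snd p"] by simp
    with p show "norm p \<le> L + T" by (auto simp: K_def)
  qed
  ultimately have "compact K" by (simp add: compact_eq_bounded_closed)
  moreover have "max_affine K g"
    unfolding max_affine_def
  proof (intro allI conjI)
    fix x
    show "\<forall>p\<in>K. aff p x \<le> g x" by (auto simp: K_def)
    obtain p where p: "\<And>z. aff p z \<le> g z" "g x \<le> aff p x"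
      using affine_sandwich[OF gc, of "{x}" "g x"] by auto
    then have px: "aff p x = g x" by (simp add: antisym)
    obtain y where y: "y \<in> cball 0 R" "g x = f y + L * norm (x - y)"
      unfolding g_def using lip_reg_attained[OF f R] by metis
    let ?u = "fst p"
    \<comment> \<open>Moving from the contact point \<open>x\<close> in the direction of the slope
      \<open>?u\<close> raises \<open>aff p\<close> by the square of \<open>norm ?u\<close>, but
      \<open>g\<close> by at most \<open>L * norm ?u\<close>; hence
      \<open>norm ?u \<le> L\<close>.\<close>
    have "aff p (x + ?u) \<le> f y + L * norm (x + ?u - y)"
      using p(1)[of "x + ?u"] lip_reg_le[OF f R y(1), of L "x + ?u"] by (simp add: g_def)
    also have "L * norm (x + ?u - y) \<le> L * (norm (x - y) + norm ?u)"
      using norm_triangle_ineq[of "x - y" ?u] L by (intro mult_left_mono) (auto simp: algebra_simps)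
    also have "f y + \<dots> = g x + L * norm ?u" using y by (simp add: algebra_simps)
    also have "aff p (x + ?u) = aff p x + norm ?u * norm ?u"
      by (simp add: aff_def inner_add_right power2_norm_eq_inner[symmetric] power2_eq_square)
    finally have "norm ?u * norm ?u \<le> L * norm ?u" using px by simp
    then have u: "norm ?u \<le> L" using L by (cases "norm ?u = 0") auto
    have "snd p \<le> g 0" using p(1)[of 0] by (simp add: aff_def)
    moreover have "snd p \<ge> - M - L * R"
    proof -
      have "?u \<bullet> (x - y) \<le> norm ?u * norm (x - y)" by (rule norm_cauchy_schwarz)
      also have "\<dots> \<le> L * norm (x - y)" using u by (intro mult_right_mono) auto
      finally have 1: "?u \<bullet> x - ?u \<bullet> y \<le> L * norm (x - y)" by (simp add: inner_diff_right)
      have "?u \<bullet> y \<le> norm ?u * norm y" by (rule norm_cauchy_schwarz)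
      also have "\<dots> \<le> L * R" using u y L by (intro mult_mono) auto
      finally have "?u \<bullet> y \<le> L * R" .
      moreover have "snd p = f y + L * norm (x - y) - ?u \<bullet> x" using px y by (simp add: aff_def)
      ultimately show ?thesis using 1 M[OF y(1)] by linarith
    qed
    moreover have "M \<ge> 0" "L * R \<ge> 0" using M[OF y(1)] L R by auto
    ultimately have "\<bar>snd p\<bar> \<le> T" unfolding T_def by linarith
    with u p(1) have "p \<in> K" by (simp add: K_def)
    with px show "\<exists>p\<in>K. g x = aff p x" by metis
  qed
  ultimately show ?thesis unfolding g_def by (rule Conv_cdI)
qed

lemma lip_reg_eq:
  assumes f: "f \<in> Conv" and R: "R > 0" and x: "x \<in> cball 0 R"
    and lip: "\<And>y. y \<in> cball 0 R \<Longrightarrow> \<bar>f x - f y\<bar> \<le> L * norm (x - y)"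
  shows "lip_reg R L f x = f x"
proof (rule antisym)
  show "lip_reg R L f x \<le> f x" using lip_reg_le[OF f R x, of L x] by simp
  obtain y where "y \<in> cball 0 R" "lip_reg R L f x = f y + L * norm (x - y)"
    using lip_reg_attained[OF f R] by metis
  with lip[of y] show "f x \<le> lip_reg R L f x" by simp
qed

lemma lip_reg_nonexpansive:
  assumes f: "f \<in> Conv" and h: "h \<in> Conv" and R: "R > 0"
    and e: "\<And>y. y \<in> cball 0 R \<Longrightarrow> \<bar>f y - h y\<bar> \<le> e"
  shows "\<bar>lip_reg R L f x - lip_reg R L h x\<bar> \<le> e"
proof -
  obtain y where y: "y \<in> cball 0 R" "lip_reg R L f x = f y + L * norm (x - y)"
    using lip_reg_attained[OF f R] by metis
  obtain z where z: "z \<in> cball 0 R" "lip_reg R L h x = h z + L * norm (x - z)"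
    using lip_reg_attained[OF h R] by metis
  show ?thesis
    using lip_reg_le[OF f R z(1), of L x] lip_reg_le[OF h R y(1), of L x] e[OF y(1)] e[OF z(1)] y z
    by linarith
qed

text \<open>
  This is why the regularization is an infimal convolution rather than a supremum of minorants: the
  valuation property needs the minimum of the regularizations to stay in \<^const>\<open>Conv_cd\<close>.
\<close>

lemma lip_reg_min:
  assumes f: "f \<in> Conv" and h: "h \<in> Conv" and m: "(\<lambda>x. min (f x) (h x)) \<in> Conv" and R: "R > 0"
  shows "lip_reg R L (\<lambda>x. min (f x) (h x)) x = min (lip_reg R L f x) (lip_reg R L h x)"
proof (rule antisym)
  obtain y where y: "y \<in> cball 0 R" "lip_reg R L f x = f y + L * norm (x - y)"
    using lip_reg_attained[OF f R] by metis
  obtain z where z: "z \<in> cball 0 R" "lip_reg R L h x = h z + L * norm (x - z)"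
    using lip_reg_attained[OF h R] by metis
  obtain w where w: "w \<in> cball 0 R"
    "lip_reg R L (\<lambda>x. min (f x) (h x)) x = min (f w) (h w) + L * norm (x - w)"
    using lip_reg_attained[OF m R] by metis
  show "lip_reg R L (\<lambda>x. min (f x) (h x)) x \<le> min (lip_reg R L f x) (lip_reg R L h x)"
    using lip_reg_le[OF m R y(1), of L x] lip_reg_le[OF m R z(1), of L x] y z by linarith
  show "min (lip_reg R L f x) (lip_reg R L h x) \<le> lip_reg R L (\<lambda>x. min (f x) (h x)) x"
    using lip_reg_le[OF f R w(1), of L x] lip_reg_le[OF h R w(1), of L x] w(2) by linarith
qed

lemma locally_uniform_limit_lip_reg:
  assumes F: "\<And>k. F k \<in> Conv" and f: "f \<in> Conv" and R: "R > 0" and lim: "locally_uniform_limit F f"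
  shows "locally_uniform_limit (\<lambda>k. lip_reg R L (F k)) (lip_reg R L f)"
proof (rule locally_uniform_limitI)
  fix r e :: real assume "e > 0"
  then have "e / 2 > 0" by simp
  from locally_uniform_limitD[OF lim this, of R]
  show "\<forall>\<^sub>F k in sequentially. \<forall>x\<in>cball 0 r. \<bar>lip_reg R L (F k) x - lip_reg R L f x\<bar> < e"
  proof eventually_elim
    case (elim k)
    have "\<bar>lip_reg R L (F k) x - lip_reg R L f x\<bar> \<le> e / 2" for x
      by (rule lip_reg_nonexpansive[OF F f R]) (use elim in \<open>auto intro: less_imp_le\<close>)
    then show ?case using \<open>e > 0\<close> by (metis field_sum_of_halves less_add_same_cancel1 le_less_trans \<open>e / 2 > 0\<close>)
  qed
qed

section \<open>Epi-convergence of finite convex functions\<close>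

text \<open>A half-space containing the moved points contains the original ones once it is widened
  by 1. A point of the small ball separated from the new hull would therefore cut off part of the
  ball of radius \<open>r + 1\<close> from the old one.\<close>

lemma cball_subset_hull_perturbed:
  fixes S :: "'a::euclidean_space set"
  assumes "finite S" and sub: "cball 0 (r + 1) \<subseteq> convex hull S" and r: "r \<ge> 0"
    and X: "\<And>y. y \<in> S \<Longrightarrow> dist (X y) y \<le> 1"
  shows "cball 0 r \<subseteq> convex hull (X ` S)"
proof (rule ccontr)
  assume "\<not> ?thesis"
  then obtain z where z: "z \<in> cball 0 r" "z \<notin> convex hull (X ` S)" by blast
  have "closed (convex hull (X ` S))"
    using assms(1) by (intro compact_imp_closed finite_imp_compact_convex_hull) auto
  then obtain a b where ab: "a \<bullet> z < b" "\<And>x. x \<in> convex hull (X ` S) \<Longrightarrow> b < a \<bullet> x"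
    using separating_hyperplane_closed_point[OF convex_convex_hull _ z(2)] by blast
  have "a \<bullet> y \<ge> b - norm a" if y: "y \<in> S" for y
  proof -
    have "a \<bullet> (X y - y) \<le> norm a * norm (X y - y)" by (rule norm_cauchy_schwarz)
    also have "\<dots> \<le> norm a * 1" using X[OF y] by (intro mult_left_mono) (auto simp: dist_norm)
    finally have "a \<bullet> X y - a \<bullet> y \<le> norm a" by (simp add: inner_diff_right)
    moreover have "b < a \<bullet> X y" using y by (intro ab hull_inc) auto
    ultimately show ?thesis by simp
  qed
  then have "convex hull S \<subseteq> {w. a \<bullet> w \<ge> b - norm a}"
    by (intro hull_minimal) (auto simp: convex_halfspace_ge)
  moreover have "(- (r + 1) / norm a) *\<^sub>R a \<in> cball 0 (r + 1)" using r by (simp add: norm_divide)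
  ultimately have "a \<bullet> ((- (r + 1) / norm a) *\<^sub>R a) \<ge> b - norm a" using sub by blast
  moreover have "a \<bullet> ((- (r + 1) / norm a) *\<^sub>R a) = - (r + 1) * norm a"
    by (cases "a = 0") (simp_all add: power2_norm_eq_inner[symmetric] power2_eq_square)
  moreover have "- (a \<bullet> z) \<le> norm a * r"
  proof -
    have "- (a \<bullet> z) \<le> norm a * norm z" using Cauchy_Schwarz_ineq2[of a z] by linarith
    also have "\<dots> \<le> norm a * r" using z(1) by (intro mult_left_mono) auto
    finally show ?thesis .
  qed
  ultimately show False using ab(1) by (simp add: algebra_simps)
qed

text \<open>Epi-convergence controls values only along recovery sequences. Taken at the vertices of
  a large cube, these are slightly moved vertices whose hull still contains the ball, and a convex
  function on a hull is bounded by its values at the generating points.\<close>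

lemma epi_converges_bounded_above:
  fixes f :: "'a::euclidean_space \<Rightarrow> real"
  assumes F: "\<And>k. F k \<in> Conv" and epi: "epi_converges F f" and r: "r \<ge> 0"
  obtains M where "\<forall>\<^sub>F k in sequentially. \<forall>x\<in>cball 0 r. F k x \<le> M"
proof -
  have "r + 1 > 0" using r by simp
  then obtain S :: "'a set" where S: "finite S" "cbox (0 - (\<Sum>i\<in>Basis. (r + 1) *\<^sub>R i)) (0 + (\<Sum>i\<in>Basis. (r + 1) *\<^sub>R i)) = convex hull S"
    by (rule cube_convex_hull)
  have sub: "cball 0 (r + 1) \<subseteq> convex hull S"
    unfolding S(2)[symmetric]
  proof
    fix x :: 'a assume "x \<in> cball 0 (r + 1)"
    then have b: "\<bar>x \<bullet> i\<bar> \<le> r + 1" if "i \<in> Basis" for i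
      using Basis_le_norm[OF that, of x] by simp
    have "- r - 1 \<le> x \<bullet> i \<and> x \<bullet> i \<le> r + 1" if "i \<in> Basis" for i
      using b[OF that] by linarith
    then show "x \<in> cbox (0 - (\<Sum>i\<in>Basis. (r + 1) *\<^sub>R i)) (0 + (\<Sum>i\<in>Basis. (r + 1) *\<^sub>R i))"
      unfolding mem_box by (intro ballI) simp
  qed
  have "\<exists>X. X \<longlonglongrightarrow> y \<and> (\<lambda>k. F k (X k)) \<longlonglongrightarrow> f y" for y
    using epi unfolding epi_converges_def by blast
  then obtain X where X: "\<And>y. X y \<longlonglongrightarrow> y" "\<And>y. (\<lambda>k. F k (X y k)) \<longlonglongrightarrow> f y" by metis
  define M where "M = Max (f ` S) + 1"
  have "\<forall>\<^sub>F k in sequentially. \<forall>y\<in>S. dist (X y k) y < 1 \<and> F k (X y k) < f y + 1"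
    using tendstoD[OF X(1)] order_tendstoD(2)[OF X(2)]
    by (intro eventually_ball_finite S ballI eventually_conj) auto
  then have "\<forall>\<^sub>F k in sequentially. \<forall>x\<in>cball 0 r. F k x \<le> M"
  proof eventually_elim
    case (elim k)
    have hull: "cball 0 r \<subseteq> convex hull ((\<lambda>y. X y k) ` S)"
      by (rule cball_subset_hull_perturbed[OF S(1) sub r]) (use elim in \<open>auto intro: less_imp_le\<close>)
    have "F k x \<le> M" if "x \<in> (\<lambda>y. X y k) ` S" for x
    proof -
      from that obtain y where y: "y \<in> S" "x = X y k" by blast
      have "f y \<le> Max (f ` S)" using y S(1) by simp
      then show ?thesis using elim y by (fastforce simp: M_def)
    qed
    moreover have "convex_on (convex hull ((\<lambda>y. X y k) ` S)) (F k)"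
      using F[of k] by (auto simp: Conv_def intro: convex_on_subset)
    ultimately show ?case using hull convex_on_convex_hull_bound by blast
  qed
  then show thesis by (rule that)
qed

lemma epi_converges_bounded:
  fixes f :: "'a::euclidean_space \<Rightarrow> real"
  assumes F: "\<And>k. F k \<in> Conv" and epi: "epi_converges F f" and r: "r \<ge> 0"
  obtains M where "\<forall>\<^sub>F k in sequentially. \<forall>x\<in>cball 0 r. \<bar>F k x\<bar> \<le> M"
proof -
  obtain M where M: "\<forall>\<^sub>F k in sequentially. \<forall>x\<in>cball 0 (r + 2). F k x \<le> M"
    using epi_converges_bounded_above[OF F epi, of "r + 2"] r by auto
  obtain X where X: "X \<longlonglongrightarrow> 0" "(\<lambda>k. F k (X k)) \<longlonglongrightarrow> f 0"
    using epi unfolding epi_converges_def by blast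
  have "\<forall>\<^sub>F k in sequentially. norm (X k) < 1"
    using tendsto_norm[OF X(1)] by (rule order_tendstoD) simp
  moreover have "\<forall>\<^sub>F k in sequentially. f 0 - 1 < F k (X k)"
    using X(2) by (rule order_tendstoD) simp
  ultimately have "\<forall>\<^sub>F k in sequentially. \<forall>x\<in>cball 0 r. \<bar>F k x\<bar> \<le> max M (M - 2 * (f 0 - 1))"
    using M
  proof eventually_elim
    case (elim k)
    show ?case
    proof
      fix x :: 'a assume x: "x \<in> cball 0 r"
      \<comment> \<open>Reflection of \<open>x\<close> in the recovery point \<open>X k\<close>:
        convexity at this midpoint turns the upper bound at \<open>y\<close> and the lower bound at
        \<open>X k\<close> into a lower bound at \<open>x\<close>. The upper bound is taken on
        radius \<open>r + 2\<close> because \<open>norm (X k) < 1\<close>.\<close>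
      define y where "y = 2 *\<^sub>R X k - x"
      have "norm y \<le> norm (2 *\<^sub>R X k) + norm x" unfolding y_def by (rule norm_triangle_ineq4)
      also have "\<dots> \<le> r + 2" using elim(1) x by simp
      finally have "F k y \<le> M" using elim(3) by simp
      moreover have "F k x \<le> M" using elim(3) x by simp
      moreover have "X k = (1 - 1 / 2) *\<^sub>R x + (1 / 2) *\<^sub>R y"
        by (simp add: y_def scaleR_diff_right)
      then have "F k (X k) \<le> (1 - 1 / 2) * F k x + (1 / 2) * F k y"
        using convex_onD[of UNIV "F k" "1 / 2" x y] F[of k] by (simp add: Conv_def)
      ultimately have "F k x \<le> M" "- F k x \<le> M - 2 * (f 0 - 1)"
        using elim(2) by (simp_all add: field_simps)
      then show "\<bar>F k x\<bar> \<le> max M (M - 2 * (f 0 - 1))"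
        by (intro abs_leI) (auto simp: le_max_iff_disj)
    qed
  qed
  then show thesis by (rule that)
qed

text \<open>Uniform bounds on a larger ball make the sequence equi-Lipschitz. This upgrades
  convergence along recovery sequences to pointwise convergence, and a finite net makes the latter
  uniform.\<close>

lemma epi_converges_imp_locally_uniform_limit:
  fixes f :: "'a::euclidean_space \<Rightarrow> real"
  assumes F: "\<And>k. F k \<in> Conv" and f: "f \<in> Conv" and epi: "epi_converges F f"
  shows "locally_uniform_limit F f"
proof (rule locally_uniform_limitI)
  fix r0 e :: real assume e: "e > 0"
  define r where "r = \<bar>r0\<bar> + 1"
  have r: "r + 1 \<ge> 0" by (simp add: r_def)
  obtain M1 where M1: "\<forall>\<^sub>F k in sequentially. \<forall>x\<in>cball 0 (r + 1). \<bar>F k x\<bar> \<le> M1"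
    using epi_converges_bounded[OF F epi r] by blast
  obtain M2 where M2: "M2 \<ge> 0" "\<And>x. x \<in> cball 0 (r + 1) \<Longrightarrow> \<bar>f x\<bar> \<le> M2"
    using Conv_bounded_on_cball[OF f] by blast
  define \<Lambda> where "\<Lambda> = 2 * max M1 M2 + 1"
  have \<Lambda>: "\<Lambda> > 0" using M2(1) by (simp add: \<Lambda>_def)
  have lip: "\<bar>h x - h y\<bar> \<le> \<Lambda> * norm (x - y)"
    if "h \<in> Conv" "\<forall>x\<in>cball 0 (r + 1). \<bar>h x\<bar> \<le> max M1 M2" "x \<in> cball 0 r" "y \<in> cball 0 r" for h and x y :: 'a
  proof -
    have "\<bar>h x - h y\<bar> \<le> 2 * max M1 M2 * norm (x - y)"
      by (rule convex_on_imp_lipschitz[where r = r]) (use that in \<open>auto simp: Conv_def\<close>)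
    also have "\<dots> \<le> \<Lambda> * norm (x - y)" by (intro mult_right_mono) (auto simp: \<Lambda>_def)
    finally show ?thesis .
  qed
  have lipf: "\<bar>f x - f y\<bar> \<le> \<Lambda> * norm (x - y)" if "x \<in> cball 0 r" "y \<in> cball 0 r" for x y
    by (rule lip[OF f]) (use M2 that in \<open>auto simp: le_max_iff_disj\<close>)
  have lipF: "\<forall>\<^sub>F k in sequentially. \<forall>x\<in>cball 0 r. \<forall>y\<in>cball 0 r. \<bar>F k x - F k y\<bar> \<le> \<Lambda> * norm (x - y)"
    using M1
  proof eventually_elim
    case (elim k)
    show ?case
      by (intro ballI lip[OF F]) (use elim in \<open>auto simp: le_max_iff_disj\<close>)
  qed
  have ptw: "(\<lambda>k. F k x) \<longlonglongrightarrow> f x" if x: "x \<in> cball 0 r0" for x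
  proof -
    obtain X where X: "X \<longlonglongrightarrow> x" "(\<lambda>k. F k (X k)) \<longlonglongrightarrow> f x"
      using epi unfolding epi_converges_def by blast
    have "norm x < r" using x by (simp add: r_def)
    then have "\<forall>\<^sub>F k in sequentially. norm (X k) < r"
      using tendsto_norm[OF X(1)] order_tendstoD(2) by blast
    with lipF have "\<forall>\<^sub>F k in sequentially. norm (F k x - F k (X k)) \<le> norm (x - X k) * \<Lambda>"
      by eventually_elim (use \<open>norm x < r\<close> in \<open>auto simp: mult.commute\<close>)
    moreover have "(\<lambda>k. x - X k) \<longlonglongrightarrow> 0"
      using tendsto_diff[OF tendsto_const X(1), of x] by simp
    ultimately have "(\<lambda>k. F k x - F k (X k)) \<longlonglongrightarrow> 0"
      by (rule tendsto_0_le[rotated])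
    from tendsto_add[OF this X(2)] show ?thesis by simp
  qed
  \<comment> \<open>Passing to the net costs less than \<open>e / 4\<close> for \<open>F k\<close>
    and for \<open>f\<close>, leaving \<open>e / 2\<close> for the net points. The summand 1 in
    \<open>\<Lambda>\<close> makes this division legitimate.\<close>
  define \<rho> where "\<rho> = e / (4 * \<Lambda>)"
  have \<rho>: "\<rho> > 0" using e \<Lambda> by (simp add: \<rho>_def)
  have "cball 0 r0 \<subseteq> (\<Union>x\<in>cball (0::'a) r0. ball x \<rho>)" using \<rho> by force
  then obtain A where A: "A \<subseteq> cball (0::'a) r0" "finite A" "cball 0 r0 \<subseteq> (\<Union>x\<in>A. ball x \<rho>)"
    using compactE_image[OF compact_cball, of "cball (0::'a) r0" "\<lambda>x. ball x \<rho>" 0 r0] by auto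
  have "\<forall>\<^sub>F k in sequentially. \<forall>z\<in>A. \<bar>F k z - f z\<bar> < e / 2"
    using tendstoD[OF ptw, of _ "e / 2"] A(1) e
    by (intro eventually_ball_finite A(2) ballI) (auto simp: dist_real_def)
  with lipF show "\<forall>\<^sub>F k in sequentially. \<forall>x\<in>cball 0 r0. \<bar>F k x - f x\<bar> < e"
  proof eventually_elim
    case (elim k)
    show ?case
    proof
      fix x :: 'a assume x: "x \<in> cball 0 r0"
      then obtain z where z: "z \<in> A" "dist z x < \<rho>" using A(3) by auto
      have xz: "x \<in> cball 0 r" "z \<in> cball 0 r" using x z(1) A(1) by (auto simp: r_def)
      have "\<Lambda> * norm (x - z) < \<Lambda> * \<rho>" using z(2) \<Lambda> by (simp add: dist_norm norm_minus_commute)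
      also have "\<dots> = e / 4" using \<Lambda> by (simp add: \<rho>_def)
      finally have "\<Lambda> * norm (x - z) < e / 4" .
      moreover have "\<bar>F k x - F k z\<bar> \<le> \<Lambda> * norm (x - z)" using elim(1) xz by blast
      moreover have "\<bar>f x - f z\<bar> \<le> \<Lambda> * norm (x - z)" by (rule lipf[OF xz])
      moreover have "\<bar>F k z - f z\<bar> < e / 2" using elim(2) z(1) by blast
      ultimately show "\<bar>F k x - f x\<bar> < e" by linarith
    qed
  qed
qed

section \<open>The extension\<close>

lemma continuous_map_epi_topologyI:
  assumes "\<And>F f. (\<And>k. F k \<in> Conv) \<Longrightarrow> f \<in> Conv \<Longrightarrow> locally_uniform_limit F f \<Longrightarrow> (\<lambda>k. W (F k)) \<longlonglongrightarrow> W f"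
  shows "continuous_map epi_topology euclideanreal W"
proof -
  have "openin epi_topology {f \<in> Conv. W f \<in> U}" if U: "open U" for U
    unfolding openin_epi_topology
  proof (intro conjI allI ballI impI)
    fix F f assume f: "f \<in> {f \<in> Conv. W f \<in> U}" and F: "\<forall>k. F k \<in> Conv" and "epi_converges F f"
    then have "locally_uniform_limit F f"
      by (intro epi_converges_imp_locally_uniform_limit) auto
    then have "(\<lambda>k. W (F k)) \<longlonglongrightarrow> W f" using f F by (intro assms) auto
    then have "\<forall>\<^sub>F k in sequentially. W (F k) \<in> U"
      using U f by (auto dest: topological_tendstoD)
    then show "\<forall>\<^sub>F k in sequentially. F k \<in> {f \<in> Conv. W f \<in> U}"
      by (rule eventually_mono) (use F in auto)
  qed auto
  then show ?thesis by (simp add: continuous_map_def)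
qed

text \<open>On any given ball \<open>f\<close> even coincides with a member of
  \<open>Conv_cd\<close>, namely its regularization with the Lipschitz constant valid there.\<close>

lemma Conv_cd_dense:
  assumes f: "f \<in> Conv"
  obtains G where "\<And>k. G k \<in> Conv_cd" "locally_uniform_limit G f"
proof -
  have "\<exists>g\<in>Conv_cd. \<forall>x\<in>cball 0 (real k + 1). g x = f x" for k
  proof -
    obtain B where B: "B \<ge> 0" "\<And>x. x \<in> cball 0 (real k + 1 + 1) \<Longrightarrow> \<bar>f x\<bar> \<le> B"
      using Conv_bounded_on_cball[OF f] by blast
    have "lip_reg (real k + 1) (2 * B) f x = f x" if "x \<in> cball 0 (real k + 1)" for x
      using that f B(2) by (intro lip_reg_eq convex_on_imp_lipschitz) (auto simp: Conv_def)
    moreover have "lip_reg (real k + 1) (2 * B) f \<in> Conv_cd"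
      using B by (intro lip_reg_Conv_cd f) auto
    ultimately show ?thesis by blast
  qed
  then obtain G where G: "\<And>k. G k \<in> Conv_cd" "\<And>k x. x \<in> cball 0 (real k + 1) \<Longrightarrow> G k x = f x"
    by metis
  have "locally_uniform_limit G f"
  proof (rule locally_uniform_limitI)
    fix r e :: real assume "e > 0"
    have "\<forall>\<^sub>F k in sequentially. k \<ge> nat \<lceil>r\<rceil>" by (rule eventually_ge_at_top)
    then show "\<forall>\<^sub>F k in sequentially. \<forall>x\<in>cball 0 r. \<bar>G k x - f x\<bar> < e"
    proof eventually_elim
      case (elim k)
      then have "r \<le> real k + 1" by linarith
      then have "G k x = f x" if "x \<in> cball 0 r" for x using that by (intro G(2)) auto
      then show ?case using \<open>e > 0\<close> by simp
    qed
  qed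
  with G(1) show thesis by (rule that)
qed

context polynomial_valuation
begin

text \<open>Any representative in \<open>Conv_cd\<close> agreeing with \<open>f\<close> on the ball
  may be chosen, as locality makes the value independent of it. Keeping the Lipschitz constant out
  of the definition lets each later argument pick its own.\<close>

definition extension :: "real \<Rightarrow> ('a \<Rightarrow> real) \<Rightarrow> real" where
  "extension R f = Z (SOME g. g \<in> Conv_cd \<and> (\<forall>x\<in>cball 0 R. g x = f x))"

lemma extension_eq:
  assumes R: "local_radius R" and g: "g \<in> Conv_cd" "\<And>x. x \<in> cball 0 R \<Longrightarrow> g x = f x"
  shows "extension R f = Z g"
proof -
  let ?P = "\<lambda>g. g \<in> Conv_cd \<and> (\<forall>x\<in>cball 0 R. g x = f x)"
  have "?P (SOME g. ?P g)" by (rule someI[of ?P g]) (use g in blast)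
  then show ?thesis
    unfolding extension_def using g by (intro Z_eq_if_eq_on_ball[OF R]) auto
qed

lemma extension_eq_lip_reg:
  assumes R: "local_radius R" and f: "f \<in> Conv"
    and B: "B \<ge> 0" "\<And>x. x \<in> cball 0 (R + 1) \<Longrightarrow> \<bar>f x\<bar> \<le> B"
  shows "extension R f = Z (lip_reg R (2 * B) f)" "\<And>x. x \<in> cball 0 R \<Longrightarrow> lip_reg R (2 * B) f x = f x"
proof -
  have R0: "R > 0" using R by (simp add: local_radius_def)
  show eq: "lip_reg R (2 * B) f x = f x" if "x \<in> cball 0 R" for x
    using that f B(2) R0 by (intro lip_reg_eq convex_on_imp_lipschitz) (auto simp: Conv_def)
  show "extension R f = Z (lip_reg R (2 * B) f)"
    using B(1) by (intro extension_eq[OF R] lip_reg_Conv_cd f R0 eq) auto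
qed

lemma extension_tendsto:
  assumes R: "local_radius R" and F: "\<And>k. F k \<in> Conv" and f: "f \<in> Conv" and lim: "locally_uniform_limit F f"
  shows "(\<lambda>k. extension R (F k)) \<longlonglongrightarrow> extension R f"
proof -
  have R0: "R > 0" using R by (simp add: local_radius_def)
  obtain B where B: "B \<ge> 0" "\<And>x. x \<in> cball 0 (R + 1) \<Longrightarrow> \<bar>f x\<bar> \<le> B"
    using Conv_bounded_on_cball[OF f] by blast
  have "\<forall>\<^sub>F k in sequentially. \<forall>x\<in>cball 0 (R + 1). \<bar>F k x - f x\<bar> < 1"
    by (rule locally_uniform_limitD[OF lim]) simp
  \<comment> \<open>One constant must serve the limit and almost all members of the sequence;
    \<open>B + 1\<close> bounds them all on the larger ball.\<close>
  then have ev: "\<forall>\<^sub>F k in sequentially. Z (lip_reg R (2 * (B + 1)) (F k)) = extension R (F k)"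
  proof eventually_elim
    case (elim k)
    have "\<bar>F k x\<bar> \<le> B + 1" if "x \<in> cball 0 (R + 1)" for x
    proof -
      have "\<bar>F k x - f x\<bar> < 1" using elim that by blast
      with B(2)[OF that] show ?thesis by linarith
    qed
    with B(1) show ?case by (intro extension_eq_lip_reg(1)[OF R F, symmetric]) auto
  qed
  have "(\<lambda>k. Z (lip_reg R (2 * (B + 1)) (F k))) \<longlonglongrightarrow> Z (lip_reg R (2 * (B + 1)) f)"
    using B(1) by (intro Z_tendsto lip_reg_Conv_cd F f R0 locally_uniform_limit_lip_reg lim) auto
  moreover have "extension R f = Z (lip_reg R (2 * (B + 1)) f)"
    using B by (intro extension_eq_lip_reg(1)[OF R f]) (auto intro: add_increasing2)
  ultimately show ?thesis using ev by (simp add: Lim_transform_eventually)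
qed

lemma valuation_on_extension:
  assumes R: "local_radius R"
  shows "valuation_on Conv (extension R)"
  unfolding valuation_on_def
proof (intro ballI impI)
  fix f h :: "'a \<Rightarrow> real"
  assume f: "f \<in> Conv" and h: "h \<in> Conv" and mn: "(\<lambda>x. min (f x) (h x)) \<in> Conv"
  have R0: "R > 0" using R by (simp add: local_radius_def)
  obtain B1 where B1: "B1 \<ge> 0" "\<And>x. x \<in> cball 0 (R + 1) \<Longrightarrow> \<bar>f x\<bar> \<le> B1"
    using Conv_bounded_on_cball[OF f] by blast
  obtain B2 where B2: "B2 \<ge> 0" "\<And>x. x \<in> cball 0 (R + 1) \<Longrightarrow> \<bar>h x\<bar> \<le> B2"
    using Conv_bounded_on_cball[OF h] by blast
  define B where "B = max B1 B2"
  have B0: "B \<ge> 0" using B1(1) by (simp add: B_def)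
  have Bf: "\<bar>f x\<bar> \<le> B" and Bh: "\<bar>h x\<bar> \<le> B" if "x \<in> cball 0 (R + 1)" for x
    using B1(2)[OF that] B2(2)[OF that] by (auto simp: B_def)
  have Bm: "\<bar>min (f x) (h x)\<bar> \<le> B" if "x \<in> cball 0 (R + 1)" for x
    using Bf[OF that] Bh[OF that] by linarith
  let ?E = "lip_reg R (2 * B)"
  have ef: "extension R f = Z (?E f)" "\<And>x. x \<in> cball 0 R \<Longrightarrow> ?E f x = f x"
    by (rule extension_eq_lip_reg[OF R f B0 Bf]; assumption)+
  have eh: "extension R h = Z (?E h)" "\<And>x. x \<in> cball 0 R \<Longrightarrow> ?E h x = h x"
    by (rule extension_eq_lip_reg[OF R h B0 Bh]; assumption)+
  have em: "extension R (\<lambda>x. min (f x) (h x)) = Z (?E (\<lambda>x. min (f x) (h x)))"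
    by (rule extension_eq_lip_reg(1)[OF R mn B0 Bm])
  have cd: "?E f \<in> Conv_cd" "?E h \<in> Conv_cd" "?E (\<lambda>x. min (f x) (h x)) \<in> Conv_cd"
    using B0 by (intro lip_reg_Conv_cd f h mn R0; simp)+
  have mnE: "?E (\<lambda>x. min (f x) (h x)) = (\<lambda>x. min (?E f x) (?E h x))"
    using lip_reg_min[OF f h mn R0] by blast
  \<comment> \<open>Regularization need not commute with maxima, but agreement on the ball is enough
    for this value. The minimum has to match everywhere, since membership of
    \<open>min (?E f) (?E h)\<close> in \<open>Conv_cd\<close> is required.\<close>
  have "extension R (\<lambda>x. max (f x) (h x)) = Z (\<lambda>x. max (?E f x) (?E h x))"
    by (rule extension_eq[OF R Conv_cd_max[OF cd(1,2)]]) (simp only: ef(2) eh(2))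
  also have "\<dots> = Z (?E f) + Z (?E h) - Z (\<lambda>x. min (?E f x) (?E h x))"
    using Z_max_min cd unfolding mnE by blast
  finally show "extension R (\<lambda>x. max (f x) (h x)) + extension R (\<lambda>x. min (f x) (h x)) =
      extension R f + extension R h"
    by (simp add: ef(1) eh(1) em mnE)
qed

lemma extension_unique:
  assumes R: "local_radius R" and W: "continuous_map epi_topology euclideanreal W"
    and eq: "\<forall>f\<in>Conv_cd. W f = Z f" and f: "f \<in> Conv"
  shows "W f = extension R f"
proof -
  obtain G where G: "\<And>k. G k \<in> Conv_cd" "locally_uniform_limit G f"
    using Conv_cd_dense[OF f] by blast
  then have GC: "G k \<in> Conv" for k using Conv_cd_subset_Conv by blast
  have "continuous_map (subtopology epi_topology Conv) euclideanreal W"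
    using W by (rule continuous_map_from_subtopology)
  then have "(\<lambda>k. W (G k)) \<longlonglongrightarrow> W f"
    by (rule continuous_map_epi_tendsto[OF _ order_refl GC f G(2)])
  moreover have "W (G k) = extension R (G k)" for k
    using extension_eq[OF R G(1), of k "G k"] eq G(1) by simp
  ultimately show ?thesis
    using extension_tendsto[OF R GC f G(2)] LIMSEQ_unique by simp
qed

end

theorem corollary1p7:
  fixes d :: nat
    and Z :: "(real ^ 'n \<Rightarrow> real) \<Rightarrow> real"
  assumes "continuous_map (subtopology epi_topology Conv_cd) euclideanreal Z"
    and "valuation_on Conv_cd Z"
    and "polynomial_on d Conv_cd Z"
  shows "\<exists>Z'. continuous_map epi_topology euclideanreal Z' \<and> valuation_on Conv Z' \<and>
              (\<forall>f\<in>Conv_cd. Z' f = Z f) \<and>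
              (\<forall>W. continuous_map epi_topology euclideanreal W \<longrightarrow> (\<forall>f\<in>Conv_cd. W f = Z f) \<longrightarrow>
                   (\<forall>f\<in>Conv. W f = Z' f))"
proof -
  interpret polynomial_valuation d Z
    using assms by unfold_locales
  obtain R where R: "local_radius R" using ex_local_radius by blast
  show ?thesis
  proof (intro exI[of _ "extension R"] conjI ballI allI impI)
    show "continuous_map epi_topology euclideanreal (extension R)"
      by (intro continuous_map_epi_topologyI extension_tendsto R)
    show "valuation_on Conv (extension R)"
      by (rule valuation_on_extension[OF R])
    show "extension R f = Z f" if "f \<in> Conv_cd" for f
      using that by (intro extension_eq[OF R]) auto
    show "W f = extension R f"
      if "continuous_map epi_topology euclideanreal W" "\<forall>f\<in>Conv_cd. W f = Z f" "f \<in> Conv" for W f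
      by (rule extension_unique[OF R that])
  qed
qed

end
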